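(* Let $A\in\mathbb{C}^{n\times n}$ be Hermitian, $\vec b\in\mathbb{C}^n$ nonzero, $k,m,s\in\mathbb{N}$ positive, $M=k+sm$. Let $\vec\theta_M=[\theta_0,\dots,\theta_{M-1}]\subset\overline{\mathbb{C}}$ (outer poles) be a list closed under complex conjugation, with $\theta_0=\infty$ and $\theta_{k+im}=\infty$ for $i=1,\dots,s-1$. Let $f=p/q$ be a rational function of type $(k-1,k)$, i.e. $p,q$ are polynomials with $\deg p\le k-1$ and $\deg q\le k$, with complex conjugate roots and poles, and let $\vec\xi_k=[\xi_0,\dots,\xi_{k-1}]$ (inner poles) be the list consisting of the roots of $q$ (with multiplicity) and $\infty$ in the remaining entries. Let $\vec y_1,\dots,\vec y_s$ be the vectors computed (in exact arithmetic, without breakdown) by the RK-compressed rational Lanczos algorithm (described in the context) applied to $f$, $A$, $\vec b$ with inner poles $\vec\xi_k$ and outer poles $\vec\theta_M$. Then for every $i=1,\dots,s$, $$\vec y_i=\mathbf{Q}_{k+im}\,f(\mathbf{T}_{k+im})\,\vec e_1\|\vec b\|_2,\qquad \mathbf{T}_{k+im}=\mathbf{Q}_{k+im}^HA\,\mathbf{Q}_{k+im},$$ where $\mathbf{Q}_{k+im}$ is the orthonormal basis of $\mathcal{Q}(A,\vec b,\vec\theta_{k+im})$ generated by the rational Lanczos algorithm and $\vec\theta_{\ell}=[\theta_0,\dots,\theta_{\ell-1}]$.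
   Context: Notation: $\overline{\mathbb{C}}=\mathbb{C}\cup\{\infty\}$; $\Pi_j$ is the set of polynomials of degree at most $j$; $\vec e_1$ is the first unit vector of the appropriate size. "Complex conjugate roots and poles" means that the multiset of roots and the multiset of poles are each closed under complex conjugation. Functions of Hermitian matrices are defined through an eigendecomposition. Rational Krylov subspace: for a square matrix $N$, a vector $\vec c$ and a list $\vec\zeta_\ell=[\zeta_0,\dots,\zeta_{\ell-1}]\subset\overline{\mathbb{C}}$ of poles none of which is an eigenvalue of $N$, $$\mathcal{Q}(N,\vec c,\vec\zeta_\ell)=\{q(N)^{-1}p(N)\vec c:\ p\in\Pi_{\ell-1}\},\qquad q(x)=\prod_{\zeta\in\vec\zeta_\ell,\ \zeta\ne\infty}(x-\zeta).$$ Rational Lanczos basis: assume no breakdown, i.e. $\dim\mathcal{Q}(A,\vec b,\vec\theta_M)=M$. The rational Lanczos algorithm produces orthonormal vectors $\vec q_1,\dots,\vec q_M$, with $\vec q_1=\vec b/\|\vec b\|_2$ (since $\theta_0=\infty$), such that for each $\ell\le M$ the matrix $\mathbf{Q}_\ell=[\vec q_1,\dots,\vec q_\ell]$ is an orthonormal basis of $\mathcal{Q}(A,\vec b,\vec\theta_\ell)$. Put $\mathbf{T}_\ell=\mathbf{Q}_\ell^HA\mathbf{Q}_\ell$. Block splitting: write $\mathbf{Q}_M=[Q_1\ Q_2\ \cdots\ Q_s]$ with $Q_1\in\mathbb{C}^{n\times(k+m)}$ and $Q_i\in\mathbb{C}^{n\times m}$ for $i\ge2$; let $T_i=Q_i^HAQ_i$.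 Because $\theta_{k+im}=\infty$ for $1\le i\le s-1$, $\mathbf{T}_M$ is block tridiagonal with respect to this splitting, and its off-diagonal block in position $(i,i+1)$ is $Q_i^HAQ_{i+1}=\vec b_i\vec e_1^H$, where $\vec b_i:=Q_i^HA\vec q_{k+im+1}$. The RK-compressed rational Lanczos algorithm (for a function $f$, inner poles $\vec\xi_k$, outer poles $\vec\theta_M$): - First cycle: set $V_1=Q_1$, $S_1=T_1$, $\vec v_1=\vec e_1\|\vec b\|_2\in\mathbb{C}^{k+m}$, $\widetilde{\vec b}_1=\vec b_1$, and $\vec y_1=Q_1f(T_1)\vec e_1\|\vec b\|_2$. - For $i=2,\dots,s$: let $U_{i-1}$ be a matrix whose columns form an orthonormal basis of $\mathcal{Q}(S_{i-1},\widetilde{\vec b}_{i-1},\vec\xi_k)$; set $$\vec w_{i-1}=-V_{i-1}U_{i-1}f(U_{i-1}^HS_{i-1}U_{i-1})U_{i-1}^H\vec v_{i-1},$$ $$V_i=[V_{i-1}U_{i-1}\ \ Q_i],\quad \vec v_i=\begin{bmatrix}U_{i-1}^H\vec v_{i-1}\\ 0\end{bmatrix},\quad S_i=\begin{bmatrix}U_{i-1}^HS_{i-1}U_{i-1}&U_{i-1}^H\widetilde{\vec b}_{i-1}\vec e_1^H\\ \vec e_1\widetilde{\vec b}_{i-1}^HU_{i-1}&T_i\end{bmatrix},\quad \widetilde{\vec b}_i=\begin{bmatrix}0\\ \vec b_i\end{bmatrix}\ (i<s),$$ $$\vec y_i=\vec y_{i-1}+\vec w_{i-1}+V_if(S_i)\vec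 v_i.$$ It is implicitly assumed that all quantities are well defined: outer poles are not eigenvalues of $A$, inner poles are not eigenvalues of the matrices $S_i$, and $f$ is defined on the spectra of all the (projected) matrices to which it is applied, including all compressions of $A$ onto subspaces arising from the column spaces of $[V_i\ Q_{i+1}\cdots Q_s]$, $[V_iU_i\ Q_{i+1}\cdots Q_s]$ and $V_iU_i$, their truncations to fewer blocks, and the trailing projections $[Q_{i}\cdots Q_j]^HA[Q_i\cdots Q_j]$ (for instance, this is automatic when the poles of $f$ lie outside the convex hull of the spectrum of $A$). *)

theory Defs
  imports
    "HOL-Computational_Algebra.Fundamental_Theorem_Algebra"
    "HOL-Library.Multiset"
    "Jordan_Normal_Form.Gauss_Jordan_Elimination"
    "Jordan_Normal_Form.Schur_Decomposition"
    "Jordan_Normal_Form.VS_Connect"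
begin

text \<open>
  Matrices and vectors are those of \<open>Jordan_Normal_Form\<close>; matrix entries, vector entries, lists and
  columns are indexed from 0, while the block index \<open>i\<close> of the algorithm runs from 1 to \<open>s\<close> as in
  the usual mathematical description.  In particular \<open>unit_vec n 0\<close> is the first unit vector, and
  the vector written \<open>q\<^sub>j\<close> mathematically is column \<open>j - 1\<close> of the basis matrix.
\<close>

definition hermitian_mat :: "complex mat \<Rightarrow> bool" where
  "hermitian_mat N \<longleftrightarrow> mat_adjoint N = N"

definition vec_norm2 :: "complex vec \<Rightarrow> real" where
  "vec_norm2 x = sqrt (\<Sum>i<dim_vec x. (cmod (x $ i))\<^sup>2)"

text \<open>The rank-one matrix \<open>x y\<^sup>H\<close>.\<close>

definition outer_prod :: "complex vec \<Rightarrow> complex vec \<Rightarrow> complex mat" where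
  "outer_prod x y = Matrix.mat (dim_vec x) (dim_vec y) (\<lambda>(i, j). x $ i * cnj (y $ j))"

text \<open>\<open>[X Y]\<close>; one of the factors may have no columns.\<close>

definition append_cols :: "complex mat \<Rightarrow> complex mat \<Rightarrow> complex mat" where
  "append_cols X Y = mat_of_cols (dim_row X) (cols X @ cols Y)"

text \<open>The columns \<open>a, \<dots>, c - 1\<close> of \<open>X\<close>.\<close>

definition col_range :: "complex mat \<Rightarrow> nat \<Rightarrow> nat \<Rightarrow> complex mat" where
  "col_range X a c = Matrix.mat (dim_row X) (c - a) (\<lambda>(r, j). X $$ (r, a + j))"

definition compression :: "complex mat \<Rightarrow> complex mat \<Rightarrow> complex mat" where
  "compression A X = mat_adjoint X * A * X"

text \<open>The columns of \<open>X\<close> form an orthonormal basis of the subspace \<open>W\<close> of \<open>\<complex>\<^sup>n\<close>.\<close>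

definition is_onb :: "nat \<Rightarrow> complex mat \<Rightarrow> complex vec set \<Rightarrow> bool" where
  "is_onb n X W \<longleftrightarrow>
     dim_row X = n \<and> mat_adjoint X * X = 1\<^sub>m (dim_col X) \<and> vec_space.col_space n X = W"

text \<open>
  Function of a matrix via a unitary eigendecomposition.  The value does not depend on the chosen
  decomposition; for Hermitian \<open>N\<close> one exists.
\<close>

definition mat_fun :: "(complex \<Rightarrow> complex) \<Rightarrow> complex mat \<Rightarrow> complex mat" where
  "mat_fun f N = (let n = dim_row N in
     SOME F. \<exists>W d. W \<in> carrier_mat n n \<and> mat_adjoint W * W = 1\<^sub>m n \<and>
       N = W * mat_diag n d * mat_adjoint W \<and>
       F = W * mat_diag n (\<lambda>i. f (d i)) * mat_adjoint W)"

definition poly_mat :: "complex poly \<Rightarrow> complex mat \<Rightarrow> complex mat" where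
  "poly_mat p N = Matrix.mat (dim_row N) (dim_row N)
     (\<lambda>(i, j). \<Sum>l\<le>degree p. coeff p l * (N ^\<^sub>m l) $$ (i, j))"

text \<open>
  Poles live in \<open>\<complex> \<union> {\<infinity>}\<close>: \<open>Some z\<close> is the finite pole \<open>z\<close>, and \<open>None\<close> is the pole at infinity.
\<close>

type_synonym pole = "complex option"

definition conj_closed :: "complex multiset \<Rightarrow> bool" where
  "conj_closed R \<longleftrightarrow> image_mset cnj R = R"

text \<open>
  The roots and poles, with multiplicity, of the rational function \<open>p / q\<close>, where \<open>p\<close> and \<open>q\<close> may
  have common roots: the multiset difference performs the cancellation.  The zero function has
  no poles.
\<close>

definition rat_roots :: "complex poly \<Rightarrow> complex poly \<Rightarrow> complex multiset" where
  "rat_roots p q = proots p - proots q"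

definition rat_poles :: "complex poly \<Rightarrow> complex poly \<Rightarrow> complex multiset" where
  "rat_poles p q = (if p = 0 then {#} else proots q - proots p)"

definition conj_closed_poles :: "pole list \<Rightarrow> bool" where
  "conj_closed_poles \<zeta> \<longleftrightarrow> image_mset (map_option cnj) (mset \<zeta>) = mset \<zeta>"

definition pole_poly :: "pole list \<Rightarrow> complex poly" where
  "pole_poly \<zeta> = (\<Prod>t\<leftarrow>\<zeta>. case t of None \<Rightarrow> 1 | Some z \<Rightarrow> [:- z, 1:])"

definition poles_avoid_spectrum :: "pole list \<Rightarrow> complex mat \<Rightarrow> bool" where
  "poles_avoid_spectrum \<zeta> N \<longleftrightarrow> (\<forall>z. Some z \<in> set \<zeta> \<longrightarrow> \<not> eigenvalue N z)"

text \<open>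
  The inverse is meaningful under \<open>poles_avoid_spectrum \<zeta> N\<close>.  The bound on the degree
  is strict, so that for nonempty \<open>\<zeta>\<close> the numerators range over polynomials of degree
  at most \<open>length \<zeta> - 1\<close>.
\<close>

definition rat_krylov :: "complex mat \<Rightarrow> complex vec \<Rightarrow> pole list \<Rightarrow> complex vec set" where
  "rat_krylov N c \<zeta> =
     {the (mat_inverse (poly_mat (pole_poly \<zeta>) N)) *\<^sub>v (poly_mat p N *\<^sub>v c) | p. degree p < length \<zeta>}"

text \<open>
  \<open>Q = [q\<^sub>1, \<dots>, q\<^sub>M]\<close> is an output of the rational Lanczos algorithm run without breakdown.  Since
  the \<open>M\<close> columns of \<open>Q\<close> are an orthonormal basis of the full rational Krylov subspace, the
  latter has dimension \<open>M\<close>.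
\<close>

definition rat_lanczos_basis ::
  "complex mat \<Rightarrow> complex vec \<Rightarrow> pole list \<Rightarrow> complex mat \<Rightarrow> bool" where
  "rat_lanczos_basis A b \<theta> Q \<longleftrightarrow>
     dim_col Q = length \<theta> \<and>
     col Q 0 = complex_of_real (1 / vec_norm2 b) \<cdot>\<^sub>v b \<and>
     (\<forall>l\<in>{1..length \<theta>}. is_onb (dim_row A) (col_range Q 0 l) (rat_krylov A b (take l \<theta>)))"

text \<open>
  \<open>blocks k m Q i j = [Q\<^sub>i \<cdots> Q\<^sub>j]\<close> for \<open>1 \<le> i\<close>, where \<open>Q\<^sub>1\<close> has \<open>k + m\<close> columns and every later
  block has \<open>m\<close> columns; it has no columns for \<open>j = i - 1\<close>, \<open>i \<ge> 2\<close>.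
\<close>

definition blocks :: "nat \<Rightarrow> nat \<Rightarrow> complex mat \<Rightarrow> nat \<Rightarrow> nat \<Rightarrow> complex mat" where
  "blocks k m Q i j = col_range Q (if i = 1 then 0 else k + (i - 1) * m) (k + j * m)"

abbreviation block :: "nat \<Rightarrow> nat \<Rightarrow> complex mat \<Rightarrow> nat \<Rightarrow> complex mat" where
  "block k m Q i \<equiv> blocks k m Q i i"

definition block_coupling ::
  "nat \<Rightarrow> nat \<Rightarrow> complex mat \<Rightarrow> complex mat \<Rightarrow> nat \<Rightarrow> complex vec" where
  "block_coupling k m A Q i = mat_adjoint (block k m Q i) *\<^sub>v (A *\<^sub>v col Q (k + i * m))"

text \<open>
  The sequences \<open>U, V, S, v, bt, w, y\<close> are a run of the RK-compressed rational Lanczos algorithm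
  on top of the rational Lanczos basis \<open>Q\<close>, where \<open>bt i\<close> stands for \<open>b\<^sub>i\<close> with a tilde.  The
  orthonormal bases \<open>U i\<close> are arbitrary, and may have fewer than \<open>k\<close> columns (even none) if the
  inner rational Krylov subspace is degenerate.
\<close>

definition rk_compressed_lanczos ::
  "(complex \<Rightarrow> complex) \<Rightarrow> complex mat \<Rightarrow> complex vec \<Rightarrow> nat \<Rightarrow> nat \<Rightarrow> nat \<Rightarrow> pole list \<Rightarrow> complex mat \<Rightarrow>
   (nat \<Rightarrow> complex mat) \<Rightarrow> (nat \<Rightarrow> complex mat) \<Rightarrow> (nat \<Rightarrow> complex mat) \<Rightarrow> (nat \<Rightarrow> complex vec) \<Rightarrow>
   (nat \<Rightarrow> complex vec) \<Rightarrow> (nat \<Rightarrow> complex vec) \<Rightarrow> (nat \<Rightarrow> complex vec) \<Rightarrow> bool" where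
  "rk_compressed_lanczos f A b k m s \<xi> Q U V S v bt w y \<longleftrightarrow>
     V 1 = block k m Q 1 \<and>
     S 1 = compression A (block k m Q 1) \<and>
     v 1 = complex_of_real (vec_norm2 b) \<cdot>\<^sub>v unit_vec (k + m) 0 \<and>
     (1 < s \<longrightarrow> bt 1 = block_coupling k m A Q 1) \<and>
     y 1 = block k m Q 1 *\<^sub>v (mat_fun f (compression A (block k m Q 1)) *\<^sub>v
             (complex_of_real (vec_norm2 b) \<cdot>\<^sub>v unit_vec (k + m) 0)) \<and>
     (\<forall>i\<in>{2..s}.
        is_onb (dim_row (S (i - 1))) (U (i - 1)) (rat_krylov (S (i - 1)) (bt (i - 1)) \<xi>) \<and>
        w (i - 1) = - ((V (i - 1) * U (i - 1)) *\<^sub>v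
             (mat_fun f (compression (S (i - 1)) (U (i - 1))) *\<^sub>v
               (mat_adjoint (U (i - 1)) *\<^sub>v v (i - 1)))) \<and>
        V i = append_cols (V (i - 1) * U (i - 1)) (block k m Q i) \<and>
        v i = (mat_adjoint (U (i - 1)) *\<^sub>v v (i - 1)) @\<^sub>v 0\<^sub>v m \<and>
        S i = four_block_mat
                (compression (S (i - 1)) (U (i - 1)))
                (mat_adjoint (U (i - 1)) * outer_prod (bt (i - 1)) (unit_vec m 0))
                (outer_prod (unit_vec m 0) (bt (i - 1)) * U (i - 1))
                (compression A (block k m Q i)) \<and>
        (i < s \<longrightarrow> bt i = 0\<^sub>v (dim_col (U (i - 1))) @\<^sub>v block_coupling k m A Q i) \<and>
        y i = y (i - 1) + w (i - 1) + V i *\<^sub>v (mat_fun f (S i) *\<^sub>v v i))"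

text \<open>A rational function with denominator \<open>q\<close> is defined on the spectrum of \<open>N\<close>.\<close>

definition denom_nonzero_on_spectrum :: "complex poly \<Rightarrow> complex mat \<Rightarrow> bool" where
  "denom_nonzero_on_spectrum q N \<longleftrightarrow> (\<forall>z. eigenvalue N z \<longrightarrow> poly q z \<noteq> 0)"

text \<open>
  A rational function with denominator \<open>q\<close> is defined on the spectra of the compressions of \<open>A\<close> onto
  the column spaces of \<open>[V\<^sub>i Q\<^sub>i\<^sub>+\<^sub>1 \<cdots> Q\<^sub>j]\<close>, \<open>[V\<^sub>i U\<^sub>i Q\<^sub>i\<^sub>+\<^sub>1 \<cdots> Q\<^sub>j]\<close> and \<open>[Q\<^sub>i \<cdots> Q\<^sub>j]\<close>.  The first two families
  contain (\<open>j = i\<close>) the compressions onto \<open>V\<^sub>i\<close> and \<open>V\<^sub>i U\<^sub>i\<close>, which are the matrices \<open>S\<^sub>i\<close> and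
  \<open>U\<^sub>i\<^sup>H S\<^sub>i U\<^sub>i\<close> of the algorithm, and (\<open>i = 1\<close>) the projections onto \<open>[Q\<^sub>1 \<cdots> Q\<^sub>j]\<close>.
\<close>

definition denom_nonzero_on_projections ::
  "complex poly \<Rightarrow> complex mat \<Rightarrow> nat \<Rightarrow> nat \<Rightarrow> nat \<Rightarrow> complex mat \<Rightarrow>
   (nat \<Rightarrow> complex mat) \<Rightarrow> (nat \<Rightarrow> complex mat) \<Rightarrow> bool" where
  "denom_nonzero_on_projections q A k m s Q U V \<longleftrightarrow>
     (\<forall>i\<in>{1..s}. \<forall>j\<in>{i..s}. denom_nonzero_on_spectrum q
        (compression A (append_cols (V i) (blocks k m Q (i + 1) j)))) \<and>
     (\<forall>i\<in>{1..<s}. \<forall>j\<in>{i..s}. denom_nonzero_on_spectrum q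
        (compression A (append_cols (V i * U i) (blocks k m Q (i + 1) j)))) \<and>
     (\<forall>i\<in>{1..s}. \<forall>j\<in>{i..s}. denom_nonzero_on_spectrum q
        (compression A (blocks k m Q i j)))"

end

(*
  Adjoining a block Q' to V_i = X and compressing X to K = X U changes f only through the coupling
  of X with Q', which has rank one and lies in the direction c that generates the inner Krylov
  space K.  Let H and S be the compressions of A to X + Q' and X, and let Hc and Sc be those to
  K + Q' and K.  Then  f(H) v - f(S) v = f(Hc) v - f(Sc) v  for v in X:
  for u = q(H)^-1 v the component of r(H) u in X is r(S) u_X + d_r(S) c, where the coefficients of
  the divided difference d_r only depend on the components of s(H) u in Q' with deg s < deg r.
  A Bezout identity lowers the degrees, so that f(H) v - f(S) v has X-component B(S) q(S)^-1 c
  with deg B < k; this lies in K, where rational Krylov spaces are exact.  The Q'-components of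
  f(H) v and f(Hc) v agree because f(H) is exact on Q' and, q being real, q(H) is self-adjoint.
  Summing this identity over the cycles telescopes to the uncompressed approximation.
*)
theory Submission
  imports Defs "HOL-Library.Function_Algebras"
begin

section \<open>Divided differences of polynomials\<close>

text \<open>Krylov exactness covers only polynomials of degree below \<open>k\<close> applied to
  \<open>q(S)^-1 c\<close>, whereas each term of the X-component taken alone has degree of about
  \<open>2k\<close>. Together the terms form the Bezoutian
  \<open>(p(x) q(y) - q(x) p(y)) / (x - y)\<close> up to sign, with a linear functional in place of
  evaluation at \<open>y\<close>; dividing by \<open>x - y\<close> brings its degree in
  \<open>x\<close> below \<open>k\<close>. This needs \<open>c\<close> to be \<open>q(S)\<close>
  times a Krylov vector, which is why the inner poles are the roots of \<open>q\<close>.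

  The polynomials \<open>p\<close> and \<open>q\<close> may share roots, and closure under
  conjugation constrains only what is left after cancellation. The argument therefore runs with a
  reduced fraction \<open>p'/q'\<close>, where \<open>q'\<close> is real, and with \<open>k\<close>
  lowered by the degree of the common factor. The zero function has no poles and is treated
  separately.

  Compressions of different sizes are compared as operators \<open>P A P\<close> on one ambient
  space. There \<open>q(P A P)\<close> may be singular off the range of \<open>P\<close>, so
  \<open>f(H) v\<close> appears as \<open>p(H) u\<close> with a solution \<open>u\<close> of
  \<open>q(H) u = v\<close> inside that range.\<close>

definition deg_less :: "'a::zero poly \<Rightarrow> nat \<Rightarrow> bool" where
  "deg_less r k \<longleftrightarrow> (\<forall>i\<ge>k. coeff r i = 0)"

text \<open>The bound 0 is meaningful for \<open>deg_less\<close>: it forces \<open>r = 0\<close>,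
  while \<open>degree r < 0\<close> never holds. This keeps \<open>deg_less_pCons\<close> free of
  side conditions.\<close>

lemma deg_less_iff: "0 < k \<Longrightarrow> deg_less r k \<longleftrightarrow> degree r < k"
  unfolding deg_less_def
  by (metis coeff_eq_0 leading_coeff_0_iff degree_0 le_less_trans linorder_not_less)

lemma deg_less_pCons: "deg_less (pCons a r) (Suc k) \<longleftrightarrow> deg_less r k"
  unfolding deg_less_def by (metis Suc_le_D Suc_le_mono coeff_pCons_Suc)

lemma deg_less_mono: "deg_less r k \<Longrightarrow> k \<le> l \<Longrightarrow> deg_less r l"
  unfolding deg_less_def by auto

text \<open>The polynomial \<open>(r(x) - r(y)) / (x - y)\<close> in \<open>x\<close>, with \<open>\<beta>\<close> applied to the powers of \<open>y\<close>.\<close>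

definition div_diff :: "('a::field poly \<Rightarrow> 'a) \<Rightarrow> 'a poly \<Rightarrow> 'a poly" where
  "div_diff \<beta> r = (\<Sum>a<degree r. monom (\<beta> (poly_shift (Suc a) r)) a)"

text \<open>The intended functional sends \<open>r\<close> to \<open>ip (papp H r u) e\<close>, one
  coordinate of \<open>r(H) u\<close>. It is linear but not multiplicative, so identities in two
  variables are checked on coefficients and not by inserting a point for the second
  variable.\<close>

locale poly_functional =
  fixes \<beta> :: "'a::field poly \<Rightarrow> 'a"
  assumes add: "\<beta> (r + r') = \<beta> r + \<beta> r'"
    and smult: "\<beta> (smult a r) = a * \<beta> r"
begin

lemma zero [simp]: "\<beta> 0 = 0"
  using smult[of 0 0] by simp

lemma coeff_div_diff: "coeff (div_diff \<beta> r) a = \<beta> (poly_shift (Suc a) r)"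
proof (cases "a < degree r")
  case True
  then show ?thesis
    unfolding div_diff_def coeff_sum by (subst sum.remove[of _ a]) (auto simp: coeff_monom intro!: sum.neutral)
next
  case False
  then have "poly_shift (Suc a) r = 0"
    by (auto simp: poly_eq_iff coeff_poly_shift intro!: coeff_eq_0)
  with False show ?thesis
    unfolding div_diff_def coeff_sum by (auto intro!: sum.neutral)
qed

text \<open>This is \<open>x r(x) - y r(y) = x (r(x) - r(y)) + (x - y) r(y)\<close>, a Horner
  recursion; \<open>papp_coupling\<close> meets the same recursion on the operator side.\<close>

lemma div_diff_pCons: "div_diff \<beta> (pCons a r) = pCons (\<beta> r) (div_diff \<beta> r)"
proof (rule poly_eqI)
  fix i
  have "poly_shift (Suc i) (pCons a r) = poly_shift i r"
    by (simp add: poly_eq_iff coeff_poly_shift)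
  then show "coeff (div_diff \<beta> (pCons a r)) i = coeff (pCons (\<beta> r) (div_diff \<beta> r)) i"
    by (cases i) (simp_all add: coeff_div_diff)
qed

lemma div_diff_add: "div_diff \<beta> (r + r') = div_diff \<beta> r + div_diff \<beta> r'"
proof (rule poly_eqI)
  fix i
  have "poly_shift (Suc i) (r + r') = poly_shift (Suc i) r + poly_shift (Suc i) r'"
    by (simp add: poly_eq_iff coeff_poly_shift)
  then show "coeff (div_diff \<beta> (r + r')) i = coeff (div_diff \<beta> r + div_diff \<beta> r') i"
    by (simp add: coeff_div_diff add)
qed

lemma div_diff_smult: "div_diff \<beta> (smult a r) = smult a (div_diff \<beta> r)"
proof (rule poly_eqI)
  fix i
  have "poly_shift (Suc i) (smult a r) = smult a (poly_shift (Suc i) r)"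
    by (simp add: poly_eq_iff coeff_poly_shift)
  then show "coeff (div_diff \<beta> (smult a r)) i = coeff (smult a (div_diff \<beta> r)) i"
    by (simp add: coeff_div_diff smult)
qed

lemma div_diff_0: "div_diff \<beta> 0 = 0"
  by (simp add: div_diff_def)

lemma deg_less_div_diff: "deg_less r (Suc k) \<Longrightarrow> deg_less (div_diff \<beta> r) k"
  unfolding deg_less_def coeff_div_diff
proof (intro allI impI)
  fix i assume "\<forall>i\<ge>Suc k. coeff r i = 0" "k \<le> i"
  then have "poly_shift (Suc i) r = 0" by (auto simp: poly_eq_iff coeff_poly_shift)
  then show "\<beta> (poly_shift (Suc i) r) = 0" by simp
qed

lemma mult_right: "poly_functional (\<lambda>r. \<beta> (p * r))"
  by standard (simp_all add: distrib_left add smult)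

text \<open>Leibniz rule: \<open>q(x) p(x) - q(y) p(y) = q(x) (p(x) - p(y)) + p(y) (q(x) -
  q(y))\<close>. The factor \<open>p(y)\<close> is absorbed into the functional.\<close>

lemma div_diff_mult: "div_diff \<beta> (q * p) = q * div_diff \<beta> p + div_diff (\<lambda>r. \<beta> (p * r)) q"
proof (induction q)
  case 0
  then show ?case by (simp add: div_diff_def)
next
  case (pCons a q)
  interpret R: poly_functional "\<lambda>r. \<beta> (p * r)" by (rule mult_right)
  have "pCons a q * p = smult a p + pCons 0 (q * p)" by simp
  then have "div_diff \<beta> (pCons a q * p) = smult a (div_diff \<beta> p) + pCons (\<beta> (q * p)) (div_diff \<beta> (q * p))"
    by (metis div_diff_add div_diff_smult div_diff_pCons)
  also have "\<dots> = pCons a q * div_diff \<beta> p + pCons (\<beta> (p * q)) (div_diff (\<lambda>r. \<beta> (p * r)) q)"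
    by (simp add: pCons.IH mult.commute[of p q])
  finally show ?case by (simp add: R.div_diff_pCons)
qed

text \<open>The Bezoutian of \<open>p\<close> and \<open>q\<close>. Expanding the divided difference
  of \<open>q * p = p * q\<close> by Leibniz in both orders trades the two long products for two
  divided differences of low degree.\<close>

lemma deg_less_bezout:
  assumes "deg_less q (Suc k)" "deg_less p (Suc k)"
  shows "deg_less (q * div_diff \<beta> p - p * div_diff \<beta> q) k"
proof -
  have "q * div_diff \<beta> p - p * div_diff \<beta> q
      = div_diff (\<lambda>r. \<beta> (q * r)) p - div_diff (\<lambda>r. \<beta> (p * r)) q"
    using div_diff_mult[of q p] div_diff_mult[of p q] by (simp add: algebra_simps)
  moreover have "deg_less (div_diff (\<lambda>r. \<beta> (q * r)) p) k" "deg_less (div_diff (\<lambda>r. \<beta> (p * r)) q) k"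
    using poly_functional.deg_less_div_diff[OF mult_right] assms by auto
  ultimately show ?thesis by (simp add: deg_less_def)
qed

end

text \<open>The coefficients of a divided difference apply the functional to shifted polynomials
  only, so agreement one degree lower suffices.\<close>

lemma div_diff_cong:
  assumes "deg_less r (Suc k)" "\<And>r'. deg_less r' k \<Longrightarrow> \<beta> r' = \<beta>' r'"
  shows "div_diff \<beta> r = div_diff \<beta>' r"
  unfolding div_diff_def
proof (intro sum.cong refl)
  fix a
  have "deg_less (poly_shift (Suc a) r) k"
    using assms(1) by (auto simp: deg_less_def coeff_poly_shift)
  then show "monom (\<beta> (poly_shift (Suc a) r)) a = monom (\<beta>' (poly_shift (Suc a) r)) a"
    using assms(2) by simp
qed

section \<open>Polynomials of linear operators\<close>

locale operator_calculus = vector_space scale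
  for scale :: "'a::field \<Rightarrow> 'b::ab_group_add \<Rightarrow> 'b"
begin

definition lin_op :: "('b \<Rightarrow> 'b) \<Rightarrow> bool" where
  "lin_op H \<longleftrightarrow> (\<forall>x y. H (x + y) = H x + H y) \<and> (\<forall>a x. H (scale a x) = scale a (H x))"

lemma lin_op_add: "lin_op H \<Longrightarrow> H (x + y) = H x + H y"
  and lin_op_scale: "lin_op H \<Longrightarrow> H (scale a x) = scale a (H x)"
  by (auto simp: lin_op_def)

lemma lin_op_0: "lin_op H \<Longrightarrow> H 0 = 0"
  using lin_op_scale[where H = H and a = 0 and x = 0] by simp

lemma lin_op_minus: "lin_op H \<Longrightarrow> H (- x) = - H x"
  using lin_op_scale[where H = H and a = "-1" and x = x] by simp

lemma lin_op_diff: "lin_op H \<Longrightarrow> H (x - y) = H x - H y"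
  using lin_op_add[of H x "- y"] lin_op_minus[where H = H and x = y] by simp

lemma lin_op_comp: "lin_op F \<Longrightarrow> lin_op G \<Longrightarrow> lin_op (\<lambda>x. F (G x))"
  and lin_op_plus: "lin_op F \<Longrightarrow> lin_op G \<Longrightarrow> lin_op (\<lambda>x. F x + G x)"
  by (auto simp: lin_op_def scale_right_distrib ac_simps)

lemma lin_op_sandwich: "lin_op A \<Longrightarrow> lin_op P \<Longrightarrow> lin_op (\<lambda>x. P (A (P x)))"
  by (auto simp: lin_op_def)

definition papp :: "('b \<Rightarrow> 'b) \<Rightarrow> 'a poly \<Rightarrow> 'b \<Rightarrow> 'b" where
  "papp H r x = fold_coeffs (\<lambda>a y. scale a x + H y) r 0"

lemma papp_0 [simp]: "papp H 0 x = 0"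
  by (simp add: papp_def)

lemma papp_pCons: "lin_op H \<Longrightarrow> papp H (pCons a r) x = scale a x + H (papp H r x)"
  by (cases "r = 0 \<and> a = 0") (auto simp: papp_def fold_coeffs_pCons_not_0_0_eq lin_op_0)

lemma papp_const: "lin_op H \<Longrightarrow> papp H [:a:] x = scale a x"
  by (simp add: papp_pCons lin_op_0)

lemma papp_1: "lin_op H \<Longrightarrow> papp H 1 x = x"
  by (simp add: papp_const flip: pCons_one)

lemma papp_add: "lin_op H \<Longrightarrow> papp H (r + r') x = papp H r x + papp H r' x"
  by (induction r r' rule: poly_induct2) (simp_all add: papp_pCons lin_op_add scale_left_distrib)

lemma papp_smult: "lin_op H \<Longrightarrow> papp H (smult a r) x = scale a (papp H r x)"
  by (induction r) (simp_all add: papp_pCons lin_op_scale scale_right_distrib)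

lemma papp_minus: "lin_op H \<Longrightarrow> papp H (- r) x = - papp H r x"
  using papp_smult[of H "-1" r x] by simp

lemma papp_diff: "lin_op H \<Longrightarrow> papp H (r - r') x = papp H r x - papp H r' x"
  using papp_add[of H r "- r'" x] papp_minus[of H r' x] by simp

lemma lin_op_papp: "lin_op H \<Longrightarrow> lin_op (papp H r)"
  by (induction r) (auto simp: lin_op_def papp_pCons scale_right_distrib ac_simps)

lemma papp_mult: "lin_op H \<Longrightarrow> papp H (r * r') x = papp H r (papp H r' x)"
  by (induction r) (simp_all add: papp_pCons papp_add papp_smult)

lemma papp_commute: "lin_op H \<Longrightarrow> papp H r (papp H r' x) = papp H r' (papp H r x)"
  by (metis papp_mult mult.commute)

lemma papp_fixed:
  assumes "lin_op H" "lin_op P" "\<And>y. P (H y) = H y" "P x = x"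
  shows "P (papp H r x) = papp H r x"
  using assms by (induction r) (simp_all add: papp_pCons lin_op_0 lin_op_add lin_op_scale)

lemma papp_intertwine:
  assumes "lin_op H" "lin_op G" "lin_op J" "\<And>y. H (J y) = J (G y)"
  shows "papp H r (J x) = J (papp G r x)"
  using assms by (induction r) (simp_all add: papp_pCons lin_op_0 lin_op_add lin_op_scale)

text \<open>While \<open>r(P A P) u\<close> stays in the range of \<open>R\<close>, compressing
  further before the next multiplication changes nothing. The last multiplication may leave that
  range, so at degree exactly \<open>k\<close> the two sides agree only after applying
  \<open>R\<close>.\<close>

lemma papp_compress_exact:
  assumes A: "lin_op A" and P: "lin_op P" and R: "lin_op R"
    and RP: "\<And>x. R (P x) = R x" and Pu: "P u = u" and Ru: "R u = u"
    and PP: "\<And>x. P (P x) = P x"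
    and K: "\<And>r. deg_less r k \<Longrightarrow> R (papp (\<lambda>x. P (A (P x))) r u) = papp (\<lambda>x. P (A (P x))) r u"
  shows "deg_less r (Suc k) \<Longrightarrow>
    papp (\<lambda>x. R (A (R x))) r u = R (papp (\<lambda>x. P (A (P x))) r u)"
proof -
  let ?H = "\<lambda>x. P (A (P x))" let ?G = "\<lambda>x. R (A (R x))"
  have H: "lin_op ?H" by (rule lin_op_sandwich[OF A P])
  have G: "lin_op ?G" by (rule lin_op_sandwich[OF A R])
  have fixP: "P (papp ?H r u) = papp ?H r u" for r
    by (rule papp_fixed) (use H P PP Pu in auto)
  have step: "papp ?G (pCons a r) u = R (papp ?H (pCons a r) u)"
    if "papp ?G r u = R (papp ?H r u)" "deg_less r k" for a r
    using that K[OF that(2)] fixP[of r]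
    by (simp add: papp_pCons H G lin_op_add[OF R] lin_op_scale[OF R] Ru RP)
  show "deg_less r (Suc k) \<Longrightarrow> ?thesis"
  proof (induction r)
    case (pCons a r)
    then have r: "deg_less r k" by (simp add: deg_less_pCons)
    with pCons have "papp ?G r u = R (papp ?H r u)"
      using deg_less_mono le_Suc_eq by blast
    then show ?case using step r by blast
  qed (simp add: lin_op_0[OF R])
qed

end

section \<open>Self-adjoint operators and the compression identity\<close>

lemma map_poly_cnj_pCons: "map_poly cnj (pCons a r) = pCons (cnj a) (map_poly cnj r)"
  by (rule poly_eqI) (simp add: coeff_map_poly coeff_pCons split: nat.split)

text \<open>Definiteness is left out because the instances \<open>dot n\<close> ignore all entries
  from index \<open>n\<close> on. \<open>krylov_compression\<close> asks for it only on the range of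
  \<open>PY\<close>.\<close>

locale cinner_space = operator_calculus scale
  for scale :: "complex \<Rightarrow> 'v::ab_group_add \<Rightarrow> 'v" (infixr \<open>*s\<close> 75) +
  fixes ip :: "'v \<Rightarrow> 'v \<Rightarrow> complex"
  assumes ip_add_left: "ip (x + y) z = ip x z + ip y z"
    and ip_scale_left: "ip (a *s x) z = a * ip x z"
    and ip_commute: "ip y x = cnj (ip x y)"
begin

definition selfadj :: "('v \<Rightarrow> 'v) \<Rightarrow> bool" where
  "selfadj H \<longleftrightarrow> lin_op H \<and> (\<forall>x y. ip (H x) y = ip x (H y))"

lemma ip_add_right: "ip z (x + y) = ip z x + ip z y"
  by (metis ip_add_left ip_commute complex_cnj_add)

lemma ip_scale_right: "ip z (a *s x) = cnj a * ip z x"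
  by (metis ip_scale_left ip_commute complex_cnj_mult)

lemma ip_0_left: "ip 0 z = 0"
  using ip_scale_left[of 0 0 z] by simp

lemma ip_0_right: "ip z 0 = 0"
  using ip_scale_right[of z 0 0] by simp

lemma ip_diff_left: "ip (x - y) z = ip x z - ip y z"
  using ip_add_left[of "x - y" y z] by simp

lemma ip_papp:
  assumes "selfadj H"
  shows "ip (papp H r x) y = ip x (papp H (map_poly cnj r) y)"
proof (induction r arbitrary: x y)
  case 0
  then show ?case by (simp add: ip_0_left ip_0_right)
next
  case (pCons a r)
  have H: "lin_op H" and HH: "\<And>x y. ip (H x) y = ip x (H y)" using assms by (auto simp: selfadj_def)
  show ?case
    using papp_intertwine[OF H H H refl, of "map_poly cnj r" y]
    by (simp add: papp_pCons[OF H] map_poly_cnj_pCons ip_add_left ip_add_right ip_scale_left ip_scale_right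
        pCons.IH HH)
qed

text \<open>Each multiplication by \<open>H\<close> carries the R-part into the range of
  \<open>P\<close> only along \<open>c\<close>. Under Horner evaluation the multiples of
  \<open>c\<close> accumulate by the recursion of \<open>div_diff_pCons\<close>.\<close>

lemma papp_coupling:
  assumes A: "lin_op A" and P: "lin_op P" and R: "lin_op R"
    and PP: "\<And>x. P (P x) = P x" and PR: "\<And>x. P (R x) = 0" 
    and c: "\<And>y. P (A (R y)) = ip y e *s c"
  defines "H \<equiv> \<lambda>x. P (A (P x + R x)) + R (A (P x + R x))"
  shows "P (papp H r u) = papp (\<lambda>x. P (A (P x))) r (P u)
    + papp (\<lambda>x. P (A (P x))) (div_diff (\<lambda>r. ip (papp H r u) e) r) c"
proof -
  let ?S = "\<lambda>x. P (A (P x))"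
  have S: "lin_op ?S" by (rule lin_op_sandwich[OF A P])
  have H: "lin_op H" unfolding H_def
    by (rule lin_op_plus[OF lin_op_comp[OF P lin_op_comp[OF A lin_op_plus[OF P R]]]
          lin_op_comp[OF R lin_op_comp[OF A lin_op_plus[OF P R]]]])
  interpret B: poly_functional "\<lambda>r. ip (papp H r u) e"
    by standard (simp_all add: papp_add[OF H] papp_smult[OF H] ip_add_left ip_scale_left)
  have PH: "P (H x) = ?S x + ip x e *s c" for x
  proof -
    have "P (H x) = P (A (P x + R x))"
      by (simp only: H_def lin_op_add[OF P] PP PR add_0_right)
    then show ?thesis by (simp add: lin_op_add[OF A] lin_op_add[OF P] c)
  qed
  show ?thesis
  proof (induction r)
    case 0
    then show ?case by (simp add: B.div_diff_0 lin_op_0[OF P])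
  next
    case (pCons a r)
    have "P (papp H (pCons a r) u) = a *s P u + ?S (P (papp H r u)) + ip (papp H r u) e *s c"
      by (simp add: papp_pCons[OF H] lin_op_add[OF P] lin_op_scale[OF P] PH PP add.assoc)
    also have "\<dots> = a *s P u + (?S (papp ?S r (P u))
        + ?S (papp ?S (div_diff (\<lambda>r. ip (papp H r u) e) r) c)) + ip (papp H r u) e *s c"
      unfolding pCons.IH lin_op_add[OF S] ..
    finally show ?case
      by (simp only: papp_pCons[OF S] B.div_diff_pCons ac_simps)
  qed
qed

text \<open>\<open>PX\<close>, \<open>PK\<close> and \<open>PY\<close> project onto X, the inner
  Krylov space K and Q'. Off the range of \<open>Z\<close> the operator \<open>q(H)\<close> is
  multiplication by \<open>q(0)\<close> and may be singular. Hence inverses are replaced by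
  solutions \<open>u\<close>, \<open>uc\<close>, \<open>s\<close>, \<open>t\<close> inside the
  subspaces together with \<open>surj\<close>, \<open>injS\<close> and \<open>injSc\<close>;
  \<open>papp H p u\<close> is then \<open>f(H) v\<close>, and \<open>\<kappa>\<close> stands for
  \<open>q(S)^-1 c\<close>.\<close>

theorem krylov_compression:
  fixes A PX PY PK :: "'v \<Rightarrow> 'v"
  defines "Z \<equiv> \<lambda>x. PX x + PY x" and "W \<equiv> \<lambda>x. PK x + PY x"
  defines "H \<equiv> \<lambda>x. Z (A (Z x))" and "Hc \<equiv> \<lambda>x. W (A (W x))"
    and "S \<equiv> \<lambda>x. PX (A (PX x))" and "Sc \<equiv> \<lambda>x. PK (A (PK x))"
  assumes A: "selfadj A" and PX: "selfadj PX" and PY: "selfadj PY" and PK: "selfadj PK"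
    and XX: "\<And>x. PX (PX x) = PX x" and YY: "\<And>x. PY (PY x) = PY x" and KK: "\<And>x. PK (PK x) = PK x"
    and XY: "\<And>x. PX (PY x) = 0" and YX: "\<And>x. PY (PX x) = 0"
    and KX: "\<And>x. PK (PX x) = PK x" and XK: "\<And>x. PX (PK x) = PK x"
    and definite: "\<And>x. ip (PY x) (PY x) = 0 \<Longrightarrow> PY x = 0"
    and c: "\<And>y. PX (A (PY y)) = ip y e *s c" and e: "PY e = e"
    and k: "0 < k" and q: "deg_less q (Suc k)" and p: "deg_less p k" and real: "map_poly cnj q = q"
    and \<kappa>: "PX \<kappa> = \<kappa>" "papp S q \<kappa> = c"
    and krylov: "\<And>r. deg_less r k \<Longrightarrow> PK (papp S r \<kappa>) = papp S r \<kappa>"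
    and surj: "\<And>y. PY y = y \<Longrightarrow> \<exists>u. Z u = u \<and> papp H q u = y"
    and injS: "\<And>x. PX x = x \<Longrightarrow> papp S q x = 0 \<Longrightarrow> x = 0"
    and injSc: "\<And>x. PK x = x \<Longrightarrow> papp Sc q x = 0 \<Longrightarrow> x = 0"
    and v: "PX v = v"
    and u: "Z u = u" "papp H q u = v"
    and uc: "W uc = uc" "papp Hc q uc = PK v"
    and s: "PX s = s" "papp S q s = v"
    and t: "PK t = t" "papp Sc q t = PK v"
  shows "papp H p u - papp S p s = papp Hc p uc - papp Sc p t"
proof -
  have lA: "lin_op A" and lX: "lin_op PX" and lY: "lin_op PY" and lK: "lin_op PK"
    using A PX PY PK by (auto simp: selfadj_def)
  have lZ: "lin_op Z" and lW: "lin_op W" unfolding Z_def W_def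
    by (rule lin_op_plus[OF lX lY], rule lin_op_plus[OF lK lY])
  have lH: "lin_op H" and lHc: "lin_op Hc" and lS: "lin_op S" and lSc: "lin_op Sc"
    unfolding H_def Hc_def S_def Sc_def 
    by (rule lin_op_sandwich[OF lA lZ], rule lin_op_sandwich[OF lA lW],
        rule lin_op_sandwich[OF lA lX], rule lin_op_sandwich[OF lA lK])
  have KY: "PK (PY x) = 0" for x using KX[of "PY x"] XY lin_op_0[OF lK] by simp
  have YK: "PY (PK x) = 0" for x using XK[of x] YX[of "PK x"] by simp
  have sZ: "selfadj Z" and sW: "selfadj W"
    using PX PY PK lZ lW by (auto simp: selfadj_def Z_def W_def ip_add_left ip_add_right)
  have sH: "selfadj H" and sHc: "selfadj Hc"
    using sZ sW A lH lHc by (auto simp: selfadj_def H_def Hc_def)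
  have ZZ: "Z (Z x) = Z x" and WW: "W (W x) = W x" and WZ: "W (Z x) = W x" for x
    by (simp_all add: Z_def W_def lin_op_add[OF lX] lin_op_add[OF lY] lin_op_add[OF lK] XX YY KK XY YX KX KY YK)
  have Wv: "W v = PK v" using v YX[of v] by (simp add: W_def)
  have WKv: "W (PK v) = PK v" by (simp add: W_def KK YK)
  have \<kappa>K: "PK \<kappa> = \<kappa>"
    using krylov[of 1] k by (simp add: papp_1[OF lS] deg_less_iff)
  have S_exact: "papp Sc r \<kappa> = PK (papp S r \<kappa>)" if "deg_less r (Suc k)" for r
    unfolding Sc_def S_def
    by (rule papp_compress_exact[OF lA lX lK KX \<kappa>(1) \<kappa>K XX krylov[unfolded S_def] that])
  have S_exact': "papp Sc r \<kappa> = papp S r \<kappa>" if "deg_less r k" for r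
    using S_exact[of r] krylov[OF that] deg_less_mono[OF that] by simp
  \<comment> \<open>Degree \<open>k\<close> is the boundary case of exactness, correct only up to
    \<open>PK\<close>. That is enough, since \<open>PK c\<close> is the coupling vector of the
    compressed operator.\<close>
  have Sc_c: "papp Sc q \<kappa> = PK c" using S_exact[OF q] \<kappa>(2) by simp
  have H_alt: "H = (\<lambda>x. PX (A (PX x + PY x)) + PY (A (PX x + PY x)))"
    by (simp add: H_def Z_def)
  have Hc_alt: "Hc = (\<lambda>x. PK (A (PK x + PY x)) + PY (A (PK x + PY x)))"
    by (simp add: Hc_def W_def)
  define \<beta> where "\<beta> x r = ip (papp H r x) e" for x r
  define \<beta>c where "\<beta>c x r = ip (papp Hc r x) e" for x r
  have top: "PX (papp H r x) = papp S r (PX x) + papp S (div_diff (\<beta> x) r) c" for r x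
    unfolding H_alt S_def \<beta>_def by (rule papp_coupling[OF lA lX lY XX XY c])
  have cK: "PK (A (PY y)) = ip y e *s PK c" for y
    using c[of y] KX[of "A (PY y)"] by (simp add: lin_op_scale[OF lK])
  have topc: "PK (papp Hc r x) = papp Sc r (PK x) + papp Sc (div_diff (\<beta>c x) r) (PK c)" for r x
    unfolding Hc_alt Sc_def \<beta>c_def by (rule papp_coupling[OF lA lK lY KK KY cK])
  have \<beta>_fun: "poly_functional (\<beta> x)" for x
    by standard (simp_all add: \<beta>_def papp_add[OF lH] papp_smult[OF lH] ip_add_left ip_scale_left)
  have fixS: "PX (papp S r x) = papp S r x" if "PX x = x" for r x
    by (rule papp_fixed[OF lS lX _ that]) (simp add: S_def XX)
  have fixSc: "PK (papp Sc r x) = papp Sc r x" if "PK x = x" for r x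
    by (rule papp_fixed[OF lSc lK _ that]) (simp add: Sc_def KK)
  have fixH: "Z (papp H r x) = papp H r x" if "Z x = x" for r x
    by (rule papp_fixed[OF lH lZ _ that]) (simp add: H_def ZZ)
  have fixHc: "W (papp Hc r x) = papp Hc r x" if "W x = x" for r x
    by (rule papp_fixed[OF lHc lW _ that]) (simp add: Hc_def WW)
  \<comment> \<open>Since \<open>c = q(S) \<kappa>\<close> and polynomials in \<open>S\<close>
    commute, the second premise says that \<open>q(S)\<close> annihilates
    \<open>x + D_q(S) \<kappa>\<close>, a vector of X; injectivity of \<open>q(S)\<close> on X
    finishes.\<close>
  have deflate: "x = - papp S (div_diff (\<beta> z) q) \<kappa>"
    if "PX x = x" "papp S q x + papp S (div_diff (\<beta> z) q) c = 0" for x z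
  proof -
    have "papp S q (x + papp S (div_diff (\<beta> z) q) \<kappa>) = 0"
      using that(2) \<kappa>(2) papp_commute[OF lS, of q _ \<kappa>] by (simp add: lin_op_add[OF lin_op_papp[OF lS]])
    moreover have "PX (x + papp S (div_diff (\<beta> z) q) \<kappa>) = x + papp S (div_diff (\<beta> z) q) \<kappa>"
      using that(1) fixS[OF \<kappa>(1)] by (simp add: lin_op_add[OF lX])
    ultimately show ?thesis using injS eq_neg_iff_add_eq_0 by blast
  qed
  \<comment> \<open>Replacing \<open>c\<close> by \<open>q(S) \<kappa>\<close> turns both terms into
    polynomials in \<open>S\<close> applied to \<open>\<kappa>\<close>, and their sum is the
    Bezoutian.\<close>
  have bez: "papp S p' (- papp S (div_diff (\<beta> x) q) \<kappa>) + papp S (div_diff (\<beta> x) p') c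
      = papp S (q * div_diff (\<beta> x) p' - p' * div_diff (\<beta> x) q) \<kappa>" for p' x
    using \<kappa>(2) papp_commute[OF lS, of q _ \<kappa>]
    by (simp add: papp_diff[OF lS] papp_mult[OF lS] lin_op_minus[OF lin_op_papp[OF lS]])
  have bez_deg: "deg_less (q * div_diff (\<beta> x) p' - p' * div_diff (\<beta> x) q) k"
    if "deg_less p' (Suc k)" for p' x
    by (rule poly_functional.deg_less_bezout[OF \<beta>_fun q that])
  \<comment> \<open>\<open>z = q(H)\<^sup>-\<^sup>1 y\<close> stays in the range of \<open>W\<close>, so moving \<open>q(H)\<close> across the inner product makes both sides equal\<close>
  have ip_Y: "ip (papp H r u) y = ip (papp Hc r uc) y" if y: "PY y = y" and r: "deg_less r (Suc k)" for r y
  proof -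
    obtain z where z: "Z z = z" "papp H q z = y" using surj[OF y] by blast
    \<comment> \<open>The right-hand side \<open>y\<close> lies in Q' and has no X-component, so the
      coupling formula for \<open>q\<close> is homogeneous and \<open>deflate\<close> applies to
      \<open>PX z\<close>.\<close>
    have "papp S q (PX z) + papp S (div_diff (\<beta> z) q) c = 0"
      using top[of q z] z(2) y XY[of y] by simp
    then have Xz: "PX z = - papp S (div_diff (\<beta> z) q) \<kappa>"
      using deflate XX by blast
    have Wz: "W (papp H r z) = papp H r z" if "deg_less r (Suc k)" for r
    proof -
      have "PX (papp H r z) = papp S (q * div_diff (\<beta> z) r - r * div_diff (\<beta> z) q) \<kappa>"
        using top[of r z] bez[of r z] Xz by simp
      then have "PK (PX (papp H r z)) = PX (papp H r z)"
        using krylov bez_deg[OF that] by simp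
      then have "W (papp H r z) = Z (papp H r z)" unfolding W_def Z_def by (simp add: KX)
      then show ?thesis using fixH[OF z(1)] by simp
    qed
    have Wz0: "W z = z" using Wz[of 1] by (simp add: papp_1[OF lH] deg_less_iff k)
    \<comment> \<open>All \<open>r(H) z\<close> of degree up to \<open>k\<close> lie in the range of
      \<open>W\<close>, so this is Krylov exactness again, now for the pair \<open>Z\<close>,
      \<open>W\<close> and the start vector \<open>z\<close>.\<close>
    have Hc_z: "papp Hc r z = papp H r z" if "deg_less r (Suc k)" for r
    proof -
      have "papp Hc r z = W (papp H r z)"
        unfolding Hc_def H_def
        by (rule papp_compress_exact[OF lA lZ lW WZ z(1) Wz0 ZZ _ that])
          (use Wz deg_less_mono[of _ k "Suc k"] in \<open>auto simp: H_def\<close>)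
      then show ?thesis using Wz[OF that] by simp
    qed
    \<comment> \<open>Moving \<open>r(H)\<close> across \<open>ip\<close> conjugates the
      coefficients of \<open>r\<close>; those of \<open>q\<close> are real, so \<open>q(H)\<close>
      moves unchanged.\<close>
    let ?r = "map_poly cnj r"
    have r': "deg_less ?r (Suc k)" using r by (simp add: deg_less_def coeff_map_poly)
    have "ip (papp H r u) y = ip (papp H r u) (papp H q z)" by (simp add: z)
    also have "\<dots> = ip u (papp H q (papp H ?r z))"
      by (simp add: ip_papp[OF sH] papp_commute[OF lH, of ?r])
    also have "\<dots> = ip v (papp H ?r z)" using ip_papp[OF sH, of q u] u(2) real by simp
    finally have 1: "ip (papp H r u) y = ip v (papp H ?r z)" .
    have "ip (papp Hc r uc) y = ip (papp Hc r uc) (papp Hc q z)" using Hc_z[OF q] z by simp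
    also have "\<dots> = ip uc (papp Hc q (papp Hc ?r z))"
      by (simp add: ip_papp[OF sHc] papp_commute[OF lHc, of ?r])
    also have "\<dots> = ip (PK v) (papp Hc ?r z)" using ip_papp[OF sHc, of q uc] uc(2) real by simp
    also have "\<dots> = ip (W v) (papp H ?r z)" using Hc_z[OF r'] Wv by simp
    also have "\<dots> = ip v (W (papp H ?r z))" using sW by (simp add: selfadj_def)
    finally have 2: "ip (papp Hc r uc) y = ip v (papp H ?r z)" using Wz[OF r'] by simp
    show ?thesis using 1 2 by simp
  qed
  have bottom: "PY (papp H p u) = PY (papp Hc p uc)"
  proof -
    let ?d = "papp H p u - papp Hc p uc"
    \<comment> \<open>The difference is tested against its own Q'-part; as \<open>PY\<close> is a
      self-adjoint projection, this gives the squared norm of that part.\<close>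
    have "ip ?d (PY ?d) = 0"
      using ip_Y[of "PY ?d" p] YY p deg_less_mono[of p k "Suc k"] by (simp add: ip_diff_left)
    then have "ip (PY ?d) (PY ?d) = 0"
      using PY YY[of ?d] by (simp add: selfadj_def)
    then have "PY ?d = 0" by (rule definite)
    then show ?thesis by (simp add: lin_op_diff[OF lY])
  qed
  \<comment> \<open>Since \<open>e\<close> lies in Q', \<open>ip_Y\<close> makes both coefficient
    functionals agree. From here on one divided difference \<open>?D\<close> serves \<open>H\<close>
    and \<open>Hc\<close>.\<close>
  have \<beta>_eq: "\<beta> u r = \<beta>c uc r" if "deg_less r k" for r
    using ip_Y[OF e] deg_less_mono[OF that] by (simp add: \<beta>_def \<beta>c_def)
  have dq: "div_diff (\<beta>c uc) q = div_diff (\<beta> u) q"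
    using div_diff_cong[OF q, of "\<beta> u" "\<beta>c uc"] \<beta>_eq by simp
  have dp: "div_diff (\<beta>c uc) p = div_diff (\<beta> u) p"
    using div_diff_cong[OF deg_less_mono[OF p], of k "\<beta> u" "\<beta>c uc"] \<beta>_eq
    by (metis div_diff_cong deg_less_mono le_SucI order_refl p)
  let ?D = "div_diff (\<beta> u)"
  have Dq: "deg_less (?D q) k" by (rule poly_functional.deg_less_div_diff[OF \<beta>_fun q])
  have "papp S q (PX u) + papp S (?D q) c = v" using top[of q u] u(2) v by simp
  \<comment> \<open>\<open>PX u\<close> and \<open>s\<close> belong to the same right-hand side
    \<open>v\<close>, so their difference satisfies the homogeneous equation of
    \<open>deflate\<close>.\<close>
  then have "PX u - s = - papp S (?D q) \<kappa>"
    using s by (intro deflate) (simp_all add: lin_op_diff[OF lX] lin_op_diff[OF lin_op_papp[OF lS]] XX algebra_simps)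
  then have Xu: "PX u = s + - papp S (?D q) \<kappa>" by (metis add_diff_cancel diff_add_cancel add.commute)
  have "PX (papp H p u) = papp S p s + (papp S p (- papp S (?D q) \<kappa>) + papp S (?D p) c)"
    unfolding top Xu lin_op_add[OF lin_op_papp[OF lS]] by (simp add: add.assoc)
  then have X: "PX (papp H p u) - papp S p s = papp S (q * ?D p - p * ?D q) \<kappa>"
    unfolding bez by simp
  have "papp Sc q (PK uc) + papp Sc (?D q) (PK c) = PK v"
    using topc[of q uc] uc(2) KK[of v] dq by simp
  moreover have "papp Sc q (papp Sc (?D q) \<kappa>) = papp Sc (?D q) (PK c)"
    using papp_commute[OF lSc, of q _ \<kappa>] Sc_c by simp
  ultimately have "papp Sc q (PK uc - t + papp Sc (?D q) \<kappa>) = 0"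
    using t(2) by (simp add: lin_op_add[OF lin_op_papp[OF lSc]] lin_op_diff[OF lin_op_papp[OF lSc]] algebra_simps)
  moreover have "PK (PK uc - t + papp Sc (?D q) \<kappa>) = PK uc - t + papp Sc (?D q) \<kappa>"
    using fixSc[OF \<kappa>K] t by (simp add: lin_op_add[OF lK] lin_op_diff[OF lK] KK)
  ultimately have "PK uc - t + papp Sc (?D q) \<kappa> = 0" by (rule injSc[rotated])
  then have Ku: "PK uc = t + - papp Sc (?D q) \<kappa>" by (simp add: algebra_simps)
  have bezc: "papp Sc p (- papp Sc (?D q) \<kappa>) + papp Sc (?D p) (PK c)
      = papp Sc (q * ?D p - p * ?D q) \<kappa>"
    using Sc_c papp_commute[OF lSc, of q _ \<kappa>]
    by (simp add: papp_diff[OF lSc] papp_mult[OF lSc] lin_op_minus[OF lin_op_papp[OF lSc]])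
  have "PK (papp Hc p uc) = papp Sc p t + (papp Sc p (- papp Sc (?D q) \<kappa>) + papp Sc (?D p) (PK c))"
    unfolding topc Ku lin_op_add[OF lin_op_papp[OF lSc]] dp by (simp add: add.assoc)
  \<comment> \<open>The Bezoutian has degree below \<open>k\<close>, where \<open>Sc\<close> and
    \<open>S\<close> act alike on \<open>\<kappa>\<close>; hence this difference is the same vector
    as the one in \<open>X\<close>.\<close>
  then have K: "PK (papp Hc p uc) - papp Sc p t = papp S (q * ?D p - p * ?D q) \<kappa>"
    unfolding bezc using S_exact'[OF bez_deg[OF deg_less_mono[OF p]]] by simp
  have "papp H p u - papp S p s = (PX (papp H p u) - papp S p s) + PY (papp H p u)"
    using fixH[OF u(1), of p] by (simp add: Z_def diff_add_eq)
  also have "\<dots> = (PK (papp Hc p uc) - papp Sc p t) + PY (papp Hc p uc)"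
    using X K bottom by simp
  also have "\<dots> = papp Hc p uc - papp Sc p t"
    using fixHc[OF uc(1), of p] by (simp add: W_def diff_add_eq)
  finally show ?thesis .
qed

end

section \<open>Matrices as operators on sequences\<close>

text \<open>Vectors of every dimension embed into the single type \<open>nat \<Rightarrow> complex\<close>, padded with zeros, which
  turns the abstract operator calculus into statements about matrices without carrier conditions.\<close>

definition scale_fun :: "complex \<Rightarrow> (nat \<Rightarrow> complex) \<Rightarrow> nat \<Rightarrow> complex" where
  "scale_fun a x = (\<lambda>i. a * x i)"

definition dot :: "nat \<Rightarrow> (nat \<Rightarrow> complex) \<Rightarrow> (nat \<Rightarrow> complex) \<Rightarrow> complex" where
  "dot n x y = (\<Sum>i<n. x i * cnj (y i))"

definition supported :: "nat \<Rightarrow> (nat \<Rightarrow> complex) \<Rightarrow> bool" where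
  "supported n x \<longleftrightarrow> (\<forall>i\<ge>n. x i = 0)"

definition vec_fun :: "complex vec \<Rightarrow> nat \<Rightarrow> complex" where
  "vec_fun x = (\<lambda>i. if i < dim_vec x then x $ i else 0)"

definition mat_op :: "complex mat \<Rightarrow> (nat \<Rightarrow> complex) \<Rightarrow> nat \<Rightarrow> complex" where
  "mat_op N x = (\<lambda>i. if i < dim_row N then \<Sum>j<dim_col N. N $$ (i, j) * x j else 0)"

interpretation op: operator_calculus scale_fun
  by standard (auto simp: scale_fun_def fun_eq_iff algebra_simps)

interpretation op: cinner_space scale_fun "dot n" for n
  by standard (auto simp: scale_fun_def dot_def algebra_simps sum.distrib sum_distrib_left)

lemma lin_mat_op: "op.lin_op (mat_op N)"
  by (auto simp: op.lin_op_def mat_op_def scale_fun_def fun_eq_iff algebra_simps sum.distrib sum_distrib_left)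

lemma supported_mat_op: "supported (dim_row N) (mat_op N x)"
  by (simp add: supported_def mat_op_def)

lemma supported_vec_fun: "supported (dim_vec x) (vec_fun x)"
  by (simp add: supported_def vec_fun_def)

lemma vec_fun_inj: "dim_vec x = dim_vec y \<Longrightarrow> vec_fun x = vec_fun y \<Longrightarrow> x = y"
  by (rule eq_vecI) (auto simp: vec_fun_def fun_eq_iff split: if_splits)

lemma vec_fun_surj: "supported n x \<Longrightarrow> \<exists>z\<in>carrier_vec n. vec_fun z = x"
  by (rule bexI[of _ "vec n x"]) (auto simp: vec_fun_def supported_def fun_eq_iff)

lemma vec_fun_mult: "dim_vec x = dim_col N \<Longrightarrow> vec_fun (N *\<^sub>v x) = mat_op N (vec_fun x)"
  by (auto simp: vec_fun_def mat_op_def fun_eq_iff scalar_prod_def atLeast0LessThan intro!: sum.cong)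

lemma vec_fun_add: "dim_vec x = dim_vec y \<Longrightarrow> vec_fun (x + y) = vec_fun x + vec_fun y"
  by (auto simp: vec_fun_def fun_eq_iff)

lemma vec_fun_uminus: "vec_fun (- x) = - vec_fun x"
  by (auto simp: vec_fun_def fun_eq_iff)

lemma mat_op_mult: "dim_col N = dim_row N' \<Longrightarrow> mat_op (N * N') x = mat_op N (mat_op N' x)"
proof
  fix i assume d: "dim_col N = dim_row N'"
  show "mat_op (N * N') x i = mat_op N (mat_op N' x) i"
  proof (cases "i < dim_row N")
    case True
    have "(\<Sum>j<dim_col N'. (N * N') $$ (i, j) * x j)
        = (\<Sum>j<dim_col N'. \<Sum>l<dim_col N. N $$ (i, l) * (N' $$ (l, j) * x j))"
      using True d
      by (intro sum.cong refl)
        (auto simp: scalar_prod_def atLeast0LessThan sum_distrib_right sum_distrib_left algebra_simps intro!: sum.cong)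
    also have "\<dots> = (\<Sum>l<dim_col N. N $$ (i, l) * (\<Sum>j<dim_col N'. N' $$ (l, j) * x j))"
      by (subst sum.swap) (simp add: sum_distrib_left)
    finally show ?thesis using True d by (simp add: mat_op_def)
  qed (simp add: mat_op_def)
qed

lemma mat_op_one: "supported n x \<Longrightarrow> mat_op (1\<^sub>m n) x = x"
  by (auto simp: mat_op_def fun_eq_iff supported_def if_distrib[of "\<lambda>a. a * _"] cong: if_cong)

lemma mat_op_cong: "(\<And>j. j < dim_col N \<Longrightarrow> x j = y j) \<Longrightarrow> mat_op N x = mat_op N y"
  by (auto simp: mat_op_def fun_eq_iff intro!: sum.cong)

lemma mat_op_one': "dim_col N = n \<Longrightarrow> mat_op N (mat_op (1\<^sub>m n) x) = mat_op N x"
  by (rule mat_op_cong) (auto simp: mat_op_def if_distrib[of "\<lambda>a. a * _"] cong: if_cong)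

lemma mat_adjoint_dim [simp]: "dim_row (mat_adjoint N) = dim_col N" "dim_col (mat_adjoint N) = dim_row N"
  by (auto simp: mat_adjoint_def)

lemma mat_adjoint_carrier [simp]: "N \<in> carrier_mat n m \<Longrightarrow> mat_adjoint N \<in> carrier_mat m n"
  by auto

lemma mat_adjoint_index: "i < dim_col N \<Longrightarrow> j < dim_row N \<Longrightarrow> mat_adjoint N $$ (i, j) = cnj (N $$ (j, i))"
  by (simp add: mat_adjoint_def mat_of_rows_def)

lemma mat_adjoint_adjoint: "mat_adjoint (mat_adjoint N) = (N :: complex mat)"
  by (rule eq_matI) (simp_all add: mat_adjoint_index)

lemma mat_adjoint_mult:
  fixes N N' :: "complex mat"
  assumes "dim_col N = dim_row N'"
  shows "mat_adjoint (N * N') = mat_adjoint N' * mat_adjoint N"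
  by (rule eq_matI)
    (use assms in \<open>auto simp: mat_adjoint_index scalar_prod_def mult.commute intro!: sum.cong\<close>)

lemma dot_adjoint: "dot (dim_row N) (mat_op N x) y = dot (dim_col N) x (mat_op (mat_adjoint N) y)"
proof -
  have "dot (dim_row N) (mat_op N x) y = (\<Sum>i<dim_row N. \<Sum>j<dim_col N. N $$ (i, j) * x j * cnj (y i))"
    by (simp add: dot_def mat_op_def sum_distrib_right)
  also have "\<dots> = (\<Sum>j<dim_col N. \<Sum>i<dim_row N. N $$ (i, j) * x j * cnj (y i))"
    by (rule sum.swap)
  also have "\<dots> = dot (dim_col N) x (mat_op (mat_adjoint N) y)"
    by (auto simp: dot_def mat_op_def sum_distrib_left mat_adjoint_index algebra_simps intro!: sum.cong)
  finally show ?thesis .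
qed

lemma selfadj_mat_op:
  "N \<in> carrier_mat n n \<Longrightarrow> hermitian_mat N \<Longrightarrow> op.selfadj n (mat_op N)"
  unfolding op.selfadj_def hermitian_mat_def using dot_adjoint[of N] lin_mat_op by auto

lemma mat_op_inj:
  assumes "dim_row N = dim_row N'" "dim_col N = dim_col N'" "\<And>x. mat_op N x = mat_op N' x"
  shows "N = N'"
proof (rule eq_matI)
  fix i j assume ij: "i < dim_row N'" "j < dim_col N'"
  have "mat_op N (\<lambda>l. if l = j then 1 else 0) i = mat_op N' (\<lambda>l. if l = j then 1 else 0) i"
    by (simp add: assms(3))
  then show "N $$ (i, j) = N' $$ (i, j)"
    using ij assms(1,2) by (simp add: mat_op_def if_distrib[of "\<lambda>a. _ * a"] cong: if_cong)
qed (use assms in auto)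

lemma dot_self_eq_0:
  assumes "dot n x x = 0" "supported n x"
  shows "x = 0"
proof -
  have "dot n x x = complex_of_real (\<Sum>i<n. (cmod (x i))\<^sup>2)"
    by (simp add: dot_def complex_norm_square[symmetric])
  then have "(\<Sum>i<n. (cmod (x i))\<^sup>2) = 0" using assms(1) by (metis of_real_eq_0_iff)
  then have "\<forall>i<n. x i = 0" by (subst (asm) sum_nonneg_eq_0_iff) auto
  then show ?thesis using assms(2) by (auto simp: fun_eq_iff supported_def not_le[symmetric])
qed

lemma underdetermined_solution:
  fixes C :: "nat \<Rightarrow> nat \<Rightarrow> complex"
  assumes "r < n"
  shows "\<exists>x. x \<noteq> 0 \<and> supported n x \<and> (\<forall>a<r. (\<Sum>i<n. C a i * x i) = 0)"
proof -
  let ?c = "\<lambda>a. vec n (C a)"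
  \<comment> \<open>The last row is zero, which makes the determinant vanish; rows from
    \<open>r\<close> up to it carry further values of \<open>C\<close> and merely add
    equations.\<close>
  let ?M = "mat\<^sub>r n n (\<lambda>a. if a = n - 1 then 0\<^sub>v n else ?c a)"
  have "det ?M = 0" by (rule det_row_0) (use assms in auto)
  then obtain z where z: "z \<in> carrier_vec n" "z \<noteq> 0\<^sub>v n" "?M *\<^sub>v z = 0\<^sub>v n"
    using det_0_iff_vec_prod_zero_field[of ?M n] by auto
  show ?thesis
  proof (intro exI conjI allI impI)
    show "vec_fun z \<noteq> 0"
    proof
      assume "vec_fun z = 0"
      then have "z = 0\<^sub>v n" using z(1)
        by (intro eq_vecI) (auto simp: vec_fun_def fun_eq_iff split: if_splits)
      with z(2) show False by simp
    qed
    show "supported n (vec_fun z)" using supported_vec_fun[of z] z(1) by simp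
    fix a assume a: "a < r"
    then have "(?M *\<^sub>v z) $ a = (\<Sum>i<n. C a i * vec_fun z i)"
      using assms z(1) by (auto simp: scalar_prod_def vec_fun_def atLeast0LessThan intro!: sum.cong)
    then show "(\<Sum>i<n. C a i * vec_fun z i) = 0" unfolding z(3) using a assms by simp
  qed
qed

lemma scale_fun_sum_apply: "(\<Sum>l\<in>L. scale_fun (g l) (h l)) i = (\<Sum>l\<in>L. g l * h l i)"
  by (induction L rule: infinite_finite_induct) (auto simp: scale_fun_def)

lemma papp_conv_sum:
  assumes "op.lin_op H"
  shows "op.papp H r x i = (\<Sum>l\<le>degree r. coeff r l * (H ^^ l) x i)"
proof -
  have "op.papp H r x = (\<Sum>l\<le>m. scale_fun (coeff r l) ((H ^^ l) x))" if "degree r \<le> m" for m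
    using that
  proof (induction r arbitrary: m)
    case 0
    then show ?case by simp
  next
    case (pCons a r)
    show ?case
    proof (cases "r = 0")
      case True
      have "(\<Sum>l\<le>m. scale_fun (coeff [:a:] l) ((H ^^ l) x)) = (\<Sum>l\<in>{0}. scale_fun (coeff [:a:] l) ((H ^^ l) x))"
        by (rule sum.mono_neutral_right) (auto simp: coeff_pCons split: nat.splits)
      then show ?thesis using True by (simp add: op.papp_const[OF assms])
    next
      case False
      then obtain m' where m': "m = Suc m'" "degree r \<le> m'" using pCons.prems by (cases m) auto
      have H_sum: "H (\<Sum>l\<in>L. g l) = (\<Sum>l\<in>L. H (g l))" for L :: "nat set" and g
        by (induction L rule: infinite_finite_induct)
          (simp_all only: sum.infinite sum.empty sum.insert op.lin_op_0[OF assms] op.lin_op_add[OF assms] not_False_eq_True)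
      have "op.papp H (pCons a r) x = scale_fun a x + H (\<Sum>l\<le>m'. scale_fun (coeff r l) ((H ^^ l) x))"
        using pCons.IH[OF m'(2)] by (simp add: op.papp_pCons[OF assms])
      also have "\<dots> = (\<Sum>l\<le>Suc m'. scale_fun (coeff (pCons a r) l) ((H ^^ l) x))"
        by (simp add: sum.atMost_Suc_shift H_sum op.lin_op_scale[OF assms] del: sum.atMost_Suc)
      finally show ?thesis using m' by simp
    qed
  qed
  from this[OF order_refl] show ?thesis by (simp only: scale_fun_sum_apply)
qed

text \<open>The exponent 0 makes support necessary: \<open>1\<^sub>m n\<close> acts on sequences by
  truncation to the first \<open>n\<close> entries.\<close>

lemma mat_op_pow:
  assumes "N \<in> carrier_mat n n" "supported n x"
  shows "mat_op (N ^\<^sub>m l) x = (mat_op N ^^ l) x"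
  using assms(2)
proof (induction l arbitrary: x)
  case 0
  then show ?case using assms(1) by (simp add: mat_op_one)
next
  case (Suc l)
  have "dim_col (N ^\<^sub>m l) = n" using assms(1) by (metis carrier_matD(2) pow_carrier_mat)
  then have "mat_op (N ^\<^sub>m Suc l) x = mat_op (N ^\<^sub>m l) (mat_op N x)"
    using assms(1) by (simp add: mat_op_mult)
  also have "\<dots> = (mat_op N ^^ l) (mat_op N x)"
    using supported_mat_op[of N x] assms(1) by (intro Suc.IH) auto
  finally show ?case by (simp add: funpow_swap1)
qed

lemma supported_papp:
  assumes "N \<in> carrier_mat n n" "supported n x"
  shows "supported n (op.papp (mat_op N) r x)"
proof (induction r)
  case (pCons a r)
  have "(scale_fun a x + y) i = 0" if "supported n y" "n \<le> i" for y i
    using assms(2) that by (simp add: scale_fun_def supported_def)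
  with supported_mat_op[of N "op.papp (mat_op N) r x"] assms(1) show ?case
    unfolding op.papp_pCons[OF lin_mat_op] supported_def[of n "_ + _"] by auto
qed (simp add: supported_def)

lemma poly_mat_carrier [simp]: "N \<in> carrier_mat n n \<Longrightarrow> poly_mat r N \<in> carrier_mat n n"
  by (simp add: poly_mat_def)

lemma mat_op_poly_mat:
  assumes N: "N \<in> carrier_mat n n" and x: "supported n x"
  shows "mat_op (poly_mat r N) x = op.papp (mat_op N) r x"
proof
  fix i
  show "mat_op (poly_mat r N) x i = op.papp (mat_op N) r x i"
  proof (cases "i < n")
    case True
    have dc: "N ^\<^sub>m l \<in> carrier_mat n n" for l using N by simp
    have "mat_op (poly_mat r N) x i = (\<Sum>j<n. \<Sum>l\<le>degree r. coeff r l * ((N ^\<^sub>m l) $$ (i, j) * x j))"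
      using N True by (simp add: mat_op_def poly_mat_def sum_distrib_right mult.assoc)
    also have "\<dots> = (\<Sum>l\<le>degree r. coeff r l * (\<Sum>j<n. (N ^\<^sub>m l) $$ (i, j) * x j))"
      by (subst sum.swap) (simp add: sum_distrib_left)
    also have "\<dots> = (\<Sum>l\<le>degree r. coeff r l * mat_op (N ^\<^sub>m l) x i)"
      using True carrier_matD[OF dc] by (simp add: mat_op_def)
    also have "\<dots> = op.papp (mat_op N) r x i"
      unfolding mat_op_pow[OF N x] papp_conv_sum[OF lin_mat_op] ..
    finally show ?thesis .
  next
    case False
    then show ?thesis using supported_papp[OF assms, of r] N
      by (simp add: mat_op_def supported_def poly_mat_def)
  qed
qed

lemma vec_fun_poly_mat:
  assumes "N \<in> carrier_mat n n" "x \<in> carrier_vec n"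
  shows "vec_fun (poly_mat r N *\<^sub>v x) = op.papp (mat_op N) r (vec_fun x)"
  using assms mat_op_poly_mat[of N n "vec_fun x" r] supported_vec_fun[of x]
  by (subst vec_fun_mult) (auto simp: poly_mat_def)

section \<open>Rational functions of Hermitian matrices\<close>

text \<open>The \<open>n + 1\<close> vectors \<open>x, N x, ..., N^n x\<close> are linearly
  dependent; \<open>r\<close> has the coefficients of such a dependence.\<close>

lemma annihilating_poly:
  assumes N: "N \<in> carrier_mat n n" and x: "supported n x"
  shows "\<exists>r. r \<noteq> 0 \<and> op.papp (mat_op N) r x = 0"
proof -
  obtain g where g: "g \<noteq> 0" "supported (Suc n) g"
      "\<forall>a<n. (\<Sum>l<Suc n. (mat_op N ^^ l) x a * g l) = 0"
    using underdetermined_solution[of n "Suc n" "\<lambda>a l. (mat_op N ^^ l) x a"] by auto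
  define r where "r = (\<Sum>l<Suc n. monom (g l) l)"
  have cr: "coeff r l = g l" for l
    using g(2) by (simp add: r_def coeff_sum supported_def if_distrib[of g] not_less_eq_eq del: sum.lessThan_Suc cong: if_cong)
  obtain l where l: "g l \<noteq> 0" using g(1) by (auto simp: fun_eq_iff)
  have "degree r \<le> n" by (rule degree_le) (use g(2) cr in \<open>auto simp: supported_def\<close>)
  have "op.papp (mat_op N) r x a = 0" for a
  proof (cases "a < n")
    case True
    have "op.papp (mat_op N) r x a = (\<Sum>l\<le>degree r. g l * (mat_op N ^^ l) x a)"
      by (simp add: papp_conv_sum[OF lin_mat_op] cr)
    also have "\<dots> = (\<Sum>l<Suc n. g l * (mat_op N ^^ l) x a)"
    proof (rule sum.mono_neutral_left)
      show "\<forall>i\<in>{..<Suc n} - {..degree r}. g i * (mat_op N ^^ i) x a = 0"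
        using cr coeff_eq_0[of r] by (metis DiffD2 atMost_iff mult_zero_left not_le)
    qed (use \<open>degree r \<le> n\<close> in auto)
    finally show ?thesis using g(3) True by (simp add: mult.commute)
  next
    case False
    then show ?thesis using supported_papp[OF assms, of r] by (simp add: supported_def)
  qed
  moreover have "r \<noteq> 0" using l cr[of l] by auto
  ultimately show ?thesis by (auto simp: fun_eq_iff)
qed

text \<open>Take an annihilating polynomial of \<open>x\<close> of least degree and split off a root
  \<open>z\<close>: the cofactor \<open>h\<close> does not annihilate \<open>x\<close>, by
  minimality. Keeping the eigenvector in the form \<open>h(N) x\<close> lets it inherit
  orthogonality relations from \<open>x\<close>.\<close>

lemma eigenvector_in_krylov:
  assumes N: "N \<in> carrier_mat n n" and x: "supported n x" "x \<noteq> 0"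
  shows "\<exists>h z. op.papp (mat_op N) h x \<noteq> 0 \<and>
    mat_op N (op.papp (mat_op N) h x) = scale_fun z (op.papp (mat_op N) h x)"
proof -
  define Q where "Q r \<longleftrightarrow> r \<noteq> 0 \<and> op.papp (mat_op N) r x = 0" for r
  have "\<exists>r. Q r" using annihilating_poly[OF N x(1)] by (simp add: Q_def)
  then obtain r where r: "Q r" and least: "\<And>h. Q h \<Longrightarrow> degree r \<le> degree h"
    using ex_has_least_nat[of Q _ degree] by blast
  have "degree r \<noteq> 0"
  proof
    assume "degree r = 0"
    then obtain a where a: "r = [:a:]" by (rule degree_eq_zeroE)
    with r have "a \<noteq> 0" "scale_fun a x = 0" by (auto simp only: Q_def op.papp_const[OF lin_mat_op])
    then show False using x(2) unfolding op.scale_eq_0_iff by blast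
  qed
  then obtain z where "poly r z = 0"
    using fundamental_theorem_of_algebra[of r] constant_degree[of r] by auto
  then obtain h where h: "r = [:-z, 1:] * h" using poly_eq_0_iff_dvd by (auto simp: dvd_def)
  with r have h0: "h \<noteq> 0" by (auto simp: Q_def)
  then have "degree r = Suc (degree h)" unfolding h by (subst degree_mult_eq) auto
  then have "\<not> Q h" using least[of h] by auto
  then have y: "op.papp (mat_op N) h x \<noteq> 0" using h0 by (simp add: Q_def)
  let ?y = "op.papp (mat_op N) h x"
  have "op.papp (mat_op N) [:-z, 1:] ?y = 0"
    using r by (simp only: Q_def h op.papp_mult[OF lin_mat_op])
  moreover have "op.papp (mat_op N) [:-z, 1:] ?y = scale_fun (- z) ?y + mat_op N ?y"
    by (simp only: op.papp_pCons[OF lin_mat_op] op.papp_0 op.lin_op_0[OF lin_mat_op] op.scale_one add_0_right)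
  ultimately have "mat_op N ?y = scale_fun z ?y"
    by (auto simp: fun_eq_iff scale_fun_def add_eq_0_iff)
  with y show ?thesis by blast
qed

lemma orthonormal_eigenvectors:
  assumes N: "N \<in> carrier_mat n n" and herm: "hermitian_mat N" and r: "r \<le> n"
  shows "\<exists>X d. \<forall>a<r. supported n (X a) \<and> mat_op N (X a) = scale_fun (d a) (X a) \<and>
    (\<forall>b<r. dot n (X a) (X b) = (if a = b then 1 else 0))"
  using r
proof (induction r)
  case 0
  then show ?case by simp
next
  case (Suc r)
  then obtain X d where X: "\<And>a. a < r \<Longrightarrow> supported n (X a)"
      "\<And>a. a < r \<Longrightarrow> mat_op N (X a) = scale_fun (d a) (X a)"
      "\<And>a b. a < r \<Longrightarrow> b < r \<Longrightarrow> dot n (X a) (X b) = (if a = b then 1 else 0)"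
    by (metis Suc_leD)
  have sa: "dot n (mat_op N x) y = dot n x (mat_op N y)" for x y
    using selfadj_mat_op[OF N herm] by (simp add: op.selfadj_def)
  obtain x where x: "x \<noteq> 0" "supported n x" "\<forall>a<r. (\<Sum>i<n. cnj (X a i) * x i) = 0"
    using underdetermined_solution[of r n "\<lambda>a i. cnj (X a i)"] Suc.prems by auto
  \<comment> \<open>The complement of the eigenvectors found so far is invariant under the
    self-adjoint \<open>N\<close>, so it contains every \<open>h(N) x\<close>.\<close>
  have "dot n (op.papp (mat_op N) h x) (X a) = 0" if a: "a < r" for h a
  proof (induction h)
    case 0
    then show ?case by (simp only: op.papp_0 op.ip_0_left)
  next
    case (pCons c h)
    have "dot n x (X a) = 0" using x(3) a by (simp add: dot_def mult.commute)
    with pCons show ?case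
      by (simp only: op.papp_pCons[OF lin_mat_op] op.ip_add_left op.ip_scale_left sa X(2)[OF a]
          op.ip_scale_right mult_zero_right add_0_right)
  qed
  then obtain y z where y: "y \<noteq> 0" "mat_op N y = scale_fun z y" "\<And>a. a < r \<Longrightarrow> dot n y (X a) = 0"
    and y': "supported n y"
    using eigenvector_in_krylov[OF N x(2,1)] supported_papp[OF N x(2)] by metis
  define \<nu> where "\<nu> = sqrt (\<Sum>i<n. (cmod (y i))\<^sup>2)"
  have yy: "dot n y y = complex_of_real (\<nu>\<^sup>2)"
    by (simp add: dot_def \<nu>_def complex_norm_square[symmetric] sum_nonneg)
  then have \<nu>: "\<nu> \<noteq> 0" using dot_self_eq_0[OF _ y'] y(1) by auto
  define u where "u = scale_fun (complex_of_real (1 / \<nu>)) y"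
  have "supported n u" using y' by (simp add: supported_def u_def scale_fun_def)
  moreover have "mat_op N u = scale_fun z u"
    unfolding u_def op.lin_op_scale[OF lin_mat_op] y(2) by (simp add: scale_fun_def fun_eq_iff)
  moreover have "dot n u u = 1"
    unfolding u_def op.ip_scale_left op.ip_scale_right yy using \<nu> by (simp add: power2_eq_square)
  moreover have uX: "dot n u (X a) = 0" if "a < r" for a
    unfolding u_def op.ip_scale_left y(3)[OF that] by simp
  moreover have "dot n (X a) u = 0" if "a < r" for a
    using uX[OF that] op.ip_commute[of n "X a" u] by simp
  ultimately show ?case using X
    by (intro exI[of _ "X(r := u)"] exI[of _ "d(r := z)"]) (auto simp: less_Suc_eq)
qed

theorem hermitian_eigendecomposition:
  assumes N: "N \<in> carrier_mat n n" and herm: "hermitian_mat N"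
  shows "\<exists>W d. W \<in> carrier_mat n n \<and> mat_adjoint W * W = 1\<^sub>m n \<and> N = W * mat_diag n d * mat_adjoint W"
proof -
  obtain X d where X: "\<And>a. a < n \<Longrightarrow> supported n (X a)"
      "\<And>a. a < n \<Longrightarrow> mat_op N (X a) = scale_fun (d a) (X a)"
      "\<And>a b. a < n \<Longrightarrow> b < n \<Longrightarrow> dot n (X a) (X b) = (if a = b then 1 else 0)"
    using orthonormal_eigenvectors[OF N herm order_refl] by metis
  define W where "W = Matrix.mat n n (\<lambda>(i, j). X j i)"
  have W: "W \<in> carrier_mat n n" by (simp add: W_def)
  have WW: "mat_adjoint W * W = 1\<^sub>m n"
  proof (rule eq_matI)
    fix i j assume ij: "i < dim_row (1\<^sub>m n :: complex mat)" "j < dim_col (1\<^sub>m n :: complex mat)"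
    then have "(mat_adjoint W * W) $$ (i, j) = dot n (X j) (X i)"
      by (auto simp: W_def scalar_prod_def mat_adjoint_index dot_def mult.commute atLeast0LessThan
          intro!: sum.cong)
    then show "(mat_adjoint W * W) $$ (i, j) = (1\<^sub>m n :: complex mat) $$ (i, j)"
      using ij X(3) by simp
  qed (simp_all add: W_def)
  then have WW': "W * mat_adjoint W = 1\<^sub>m n"
    by (rule mat_mult_left_right_inverse[rotated 2]) (use W in auto)
  have "N * W = W * mat_diag n d"
  proof (rule eq_matI)
    fix i j assume "i < dim_row (W * mat_diag n d)" "j < dim_col (W * mat_diag n d)"
    then have ij: "i < n" "j < n" by (simp_all add: W_def mat_diag_def)
    have "(N * W) $$ (i, j) = mat_op N (X j) i"
      using N ij by (auto simp: scalar_prod_def mat_op_def W_def atLeast0LessThan intro!: sum.cong)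
    also have "\<dots> = (W * mat_diag n d) $$ (i, j)"
      using ij by (simp add: X(2) mat_diag_mult_right[OF W] scale_fun_def) (simp add: W_def)
    finally show "(N * W) $$ (i, j) = (W * mat_diag n d) $$ (i, j)" .
  qed (use N in \<open>simp_all add: W_def mat_diag_def\<close>)
  then have "W * mat_diag n d * mat_adjoint W = N * (W * mat_adjoint W)"
    using N W by (metis assoc_mult_mat mat_adjoint_carrier)
  then show ?thesis using W WW WW' N by (metis right_mult_one_mat)
qed

text \<open>The pair \<open>W\<close>, \<open>d\<close> obtained is one that witnesses the value
  chosen in \<open>mat_fun\<close>, so the argument does not have to compare different
  decompositions.\<close>

lemma mat_fun_eigendecomposition:
  assumes "N \<in> carrier_mat n n" "hermitian_mat N"
  obtains W d where "W \<in> carrier_mat n n" "mat_adjoint W * W = 1\<^sub>m n"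
    "N = W * mat_diag n d * mat_adjoint W"
    "mat_fun f N = W * mat_diag n (\<lambda>i. f (d i)) * mat_adjoint W"
proof -
  have n: "dim_row N = n" using assms(1) by simp
  have "\<exists>F W d. W \<in> carrier_mat n n \<and> mat_adjoint W * W = 1\<^sub>m n \<and>
      N = W * mat_diag n d * mat_adjoint W \<and> F = W * mat_diag n (\<lambda>i. f (d i)) * mat_adjoint W"
    using hermitian_eigendecomposition[OF assms] by blast
  from someI_ex[OF this] obtain W d where "W \<in> carrier_mat n n" "mat_adjoint W * W = 1\<^sub>m n"
    "N = W * mat_diag n d * mat_adjoint W"
    "mat_fun f N = W * mat_diag n (\<lambda>i. f (d i)) * mat_adjoint W"
    unfolding mat_fun_def Let_def n by blast
  then show ?thesis by (rule that)
qed

lemma mat_fun_carrier: "N \<in> carrier_mat n n \<Longrightarrow> hermitian_mat N \<Longrightarrow> mat_fun f N \<in> carrier_mat n n"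
  by (rule mat_fun_eigendecomposition[of N n f]) (auto simp: mat_diag_def)

lemma mat_op_one_apply: "i < n \<Longrightarrow> mat_op (1\<^sub>m n) x i = x i"
  by (simp add: mat_op_def if_distrib[of "\<lambda>a. a * _"] cong: if_cong)

lemma mat_op_mat_diag: "mat_op (mat_diag n d) x = (\<lambda>i. if i < n then d i * x i else 0)"
  by (auto simp: mat_op_def mat_diag_def fun_eq_iff if_distrib[of "\<lambda>a. a * _"] cong: if_cong)

lemma papp_mult_op: "op.papp (\<lambda>y i. d i * y i) r x = (\<lambda>i. poly r (d i) * x i)"
proof -
  have l: "op.lin_op (\<lambda>y i. d i * y i)"
    by (auto simp: op.lin_op_def scale_fun_def fun_eq_iff algebra_simps)
  show ?thesis
  proof (induction r)
    case (pCons a r)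
    have "scale_fun a x + (\<lambda>i. d i * (poly r (d i) * x i)) = (\<lambda>i. poly (pCons a r) (d i) * x i)"
      by (simp add: scale_fun_def fun_eq_iff algebra_simps)
    then show ?case unfolding op.papp_pCons[OF l] pCons.IH .
  qed (simp add: fun_eq_iff)
qed

text \<open>The function is kept apart from the fraction because the same \<open>f\<close> is later
  represented by the reduced \<open>p'/q'\<close> and, when it vanishes, by
  \<open>0/1\<close>.\<close>

definition ratio_on_spectrum ::
  "(complex \<Rightarrow> complex) \<Rightarrow> complex poly \<Rightarrow> complex poly \<Rightarrow> complex mat \<Rightarrow> bool" where
  "ratio_on_spectrum f p q N \<longleftrightarrow> (\<forall>z. eigenvalue N z \<longrightarrow> poly q z \<noteq> 0 \<and> f z = poly p z / poly q z)"

text \<open>In the coordinates of \<open>W\<close>, \<open>q(N)\<close> multiplies entry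
  \<open>i\<close> by \<open>poly q (d i)\<close>, which is nonzero because \<open>d i\<close> is an
  eigenvalue with eigenvector \<open>col W i\<close>. Dividing entrywise produces \<open>u\<close>,
  and the same formula gives injectivity.\<close>

lemma
  assumes N: "N \<in> carrier_mat n n" "hermitian_mat N"
    and f: "ratio_on_spectrum f p q N"
  shows mat_fun_rational_ex: "supported n x \<Longrightarrow>
      \<exists>u. supported n u \<and> op.papp (mat_op N) q u = x \<and> op.papp (mat_op N) p u = mat_op (mat_fun f N) x"
    and papp_denom_inj: "supported n x \<Longrightarrow> op.papp (mat_op N) q x = 0 \<Longrightarrow> x = 0"
proof -
  have f': "poly q z \<noteq> 0 \<and> f z = poly p z / poly q z" if "eigenvalue N z" for z
    using f that by (simp add: ratio_on_spectrum_def)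
  obtain W d where W: "W \<in> carrier_mat n n" "mat_adjoint W * W = 1\<^sub>m n"
      and Nd: "N = W * mat_diag n d * mat_adjoint W"
      and F: "mat_fun f N = W * mat_diag n (\<lambda>i. f (d i)) * mat_adjoint W"
    by (rule mat_fun_eigendecomposition[OF N])
  have WW': "W * mat_adjoint W = 1\<^sub>m n"
    by (rule mat_mult_left_right_inverse[OF _ _ W(2)]) (use W in auto)
  have cancel: "mat_op W (mat_op (mat_adjoint W) x) = x" if "supported n x" for x
    using mat_op_mult[of W "mat_adjoint W" x] W(1) WW' mat_op_one[OF that] by simp
  have cancel': "mat_op (mat_adjoint W) (mat_op W x) = mat_op (1\<^sub>m n) x" for x
    using mat_op_mult[of "mat_adjoint W" W x] W by simp
  have diag: "mat_op (W * mat_diag n e * mat_adjoint W) x = mat_op W (\<lambda>i. e i * mat_op (mat_adjoint W) x i)" for e x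
  proof -
    have "mat_op (W * mat_diag n e * mat_adjoint W) x = mat_op W (mat_op (mat_diag n e) (mat_op (mat_adjoint W) x))"
      using W(1) by (simp add: mat_op_mult mat_diag_def)
    also have "\<dots> = mat_op W (\<lambda>i. e i * mat_op (mat_adjoint W) x i)"
      by (rule mat_op_cong) (use W(1) in \<open>simp add: mat_op_mat_diag\<close>)
    finally show ?thesis .
  qed
  have NW: "mat_op N (mat_op W x) = mat_op W (\<lambda>i. d i * x i)" for x
    unfolding Nd diag cancel'
    by (rule mat_op_cong) (use W(1) in \<open>auto simp: mat_op_def if_distrib[of "\<lambda>a. a * _"] cong: if_cong\<close>)
  have pW: "op.papp (mat_op N) r (mat_op W x) = mat_op W (\<lambda>i. poly r (d i) * x i)" for r x
  proof -
    have "op.lin_op (\<lambda>y i. d i * y i)"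
      by (auto simp: op.lin_op_def scale_fun_def fun_eq_iff algebra_simps)
    from op.papp_intertwine[OF lin_mat_op this lin_mat_op NW] show ?thesis
      by (simp only: papp_mult_op)
  qed
  have ev: "eigenvalue N (d i)" if i: "i < n" for i
    unfolding eigenvalue_def eigenvector_def
  proof (intro exI conjI)
    let ?e = "\<lambda>l. if l = i then 1 else 0 :: complex"
    have c: "vec_fun (col W i) = mat_op W ?e"
      using W(1) i by (auto simp: vec_fun_def mat_op_def fun_eq_iff if_distrib[of "\<lambda>a. _ * a"] cong: if_cong)
    show "col W i \<in> carrier_vec (dim_row N)" using W(1) N by auto
    show "col W i \<noteq> 0\<^sub>v (dim_row N)"
    proof
      assume "col W i = 0\<^sub>v (dim_row N)"
      then have "vec_fun (col W i) = 0" by (simp add: vec_fun_def fun_eq_iff)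
      then have "mat_op (1\<^sub>m n) ?e = 0"
        using cancel'[of ?e] c by (simp only: op.lin_op_0[OF lin_mat_op])
      from fun_cong[OF this, of i] show False
        using i by (simp add: mat_op_def if_distrib[of "\<lambda>a. _ * a"] cong: if_cong)
    qed
    show "N *\<^sub>v col W i = d i \<cdot>\<^sub>v col W i"
    proof (rule vec_fun_inj)
      have "vec_fun (N *\<^sub>v col W i) = mat_op W (\<lambda>l. d l * ?e l)"
        using W(1) N NW[of ?e] by (subst vec_fun_mult) (auto simp: c)
      also have "\<dots> = mat_op W (scale_fun (d i) ?e)"
        by (rule mat_op_cong) (simp add: scale_fun_def)
      also have "\<dots> = vec_fun (d i \<cdot>\<^sub>v col W i)"
        unfolding op.lin_op_scale[OF lin_mat_op] c[symmetric]
        using W(1) by (auto simp: scale_fun_def vec_fun_def fun_eq_iff)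
      finally show "vec_fun (N *\<^sub>v col W i) = vec_fun (d i \<cdot>\<^sub>v col W i)" .
    qed (use W(1) N in auto)
  qed
  {
    assume x: "supported n x"
    define u where "u = mat_op W (\<lambda>i. mat_op (mat_adjoint W) x i / poly q (d i))"
    have "supported n u" using supported_mat_op[of W] W(1) by (auto simp: u_def)
    moreover have "op.papp (mat_op N) q u = x"
    proof -
      have "op.papp (mat_op N) q u = mat_op W (mat_op (mat_adjoint W) x)"
        unfolding u_def pW by (rule mat_op_cong) (use f'[OF ev] W(1) in auto)
      then show ?thesis using cancel[OF x] by simp
    qed
    moreover have "op.papp (mat_op N) p u = mat_op (mat_fun f N) x"
      unfolding u_def pW F diag by (rule mat_op_cong) (use f'[OF ev] W(1) in auto)
    ultimately show "\<exists>u. supported n u \<and> op.papp (mat_op N) q u = x \<and> op.papp (mat_op N) p u = mat_op (mat_fun f N) x"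
      by blast
  }
  assume x: "supported n x" "op.papp (mat_op N) q x = 0"
  let ?c = "mat_op (mat_adjoint W) x"
  have "mat_op W (\<lambda>i. poly q (d i) * ?c i) = 0"
    using x(2) pW[of q ?c] cancel[OF x(1)] by simp
  then have "mat_op (1\<^sub>m n) (\<lambda>i. poly q (d i) * ?c i) = 0"
    using cancel'[of "\<lambda>i. poly q (d i) * ?c i"] by (simp only: op.lin_op_0[OF lin_mat_op])
  then have "poly q (d i) * ?c i = 0" if "i < n" for i
    using mat_op_one_apply[OF that, of "\<lambda>i. poly q (d i) * ?c i"] by simp
  then have "?c i = 0" if "i < n" for i using f'[OF ev[OF that]] that by force
  then have "mat_op W ?c = mat_op W 0" using W(1) by (auto intro: mat_op_cong[of W ?c 0])
  then show "x = 0" using cancel[OF x(1)] by (simp only: op.lin_op_0[OF lin_mat_op])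
qed

section \<open>Compressions\<close>

definition proj :: "complex mat \<Rightarrow> (nat \<Rightarrow> complex) \<Rightarrow> nat \<Rightarrow> complex" where
  "proj B x = mat_op B (mat_op (mat_adjoint B) x)"

definition orthonormal_cols :: "complex mat \<Rightarrow> bool" where
  "orthonormal_cols B \<longleftrightarrow> mat_adjoint B * B = 1\<^sub>m (dim_col B)"

text \<open>All approximations of the algorithm are lifted to the ambient space in this form, so
  that cycles with different bases and dimensions can be added and compared.\<close>

definition projected_fun ::
  "(complex \<Rightarrow> complex) \<Rightarrow> complex mat \<Rightarrow> complex mat \<Rightarrow> (nat \<Rightarrow> complex) \<Rightarrow> nat \<Rightarrow> complex" where
  "projected_fun f A B x = mat_op B (mat_op (mat_fun f (compression A B)) (mat_op (mat_adjoint B) x))"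

lemma adjoint_mat_op_cancel:
  assumes "orthonormal_cols B"
  shows "mat_op (mat_adjoint B) (mat_op B z) = mat_op (1\<^sub>m (dim_col B)) z"
  using mat_op_mult[of "mat_adjoint B" B z] assms by (simp add: orthonormal_cols_def)

lemma proj_mat_op: "orthonormal_cols B \<Longrightarrow> proj B (mat_op B z) = mat_op B z"
  by (simp add: proj_def adjoint_mat_op_cancel mat_op_one')

lemma lin_proj: "op.lin_op (proj B)"
  unfolding proj_def[abs_def] by (rule op.lin_op_comp[OF lin_mat_op lin_mat_op])

lemma selfadj_proj: "dim_row B = n \<Longrightarrow> op.selfadj n (proj B)"
  unfolding op.selfadj_def proj_def
  using lin_proj dot_adjoint[of B] dot_adjoint[of "mat_adjoint B"]
  by (simp add: mat_adjoint_adjoint proj_def[abs_def])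

lemma proj_idem: "orthonormal_cols B \<Longrightarrow> proj B (proj B x) = proj B x"
  by (metis proj_def proj_mat_op)

lemma supported_proj: "supported (dim_row B) (proj B x)"
  unfolding proj_def by (rule supported_mat_op)

lemma compression_carrier [simp]:
  "A \<in> carrier_mat n n \<Longrightarrow> dim_row B = n \<Longrightarrow> compression A B \<in> carrier_mat (dim_col B) (dim_col B)"
  by (rule carrier_matI) (simp_all add: compression_def)

lemma mat_op_compression:
  assumes "A \<in> carrier_mat n n" "dim_row B = n"
  shows "mat_op (compression A B) z = mat_op (mat_adjoint B) (mat_op A (mat_op B z))"
  using assms by (simp add: compression_def mat_op_mult)

lemma hermitian_compression:
  assumes "A \<in> carrier_mat n n" "dim_row B = n" "hermitian_mat A"
  shows "hermitian_mat (compression A B)"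
proof -
  have B: "B \<in> carrier_mat n (dim_col B)" using assms(2) by auto
  have "mat_adjoint (mat_adjoint B * A * B) = mat_adjoint B * (mat_adjoint A * B)"
    using assms by (simp add: mat_adjoint_mult mat_adjoint_adjoint)
  also have "\<dots> = mat_adjoint B * A * B"
    using assoc_mult_mat[OF mat_adjoint_carrier[OF B] assms(1) B] assms(3) by (simp add: hermitian_mat_def)
  finally show ?thesis by (simp add: hermitian_mat_def compression_def)
qed

text \<open>\<open>B\<close> intertwines the small matrix \<open>compression A B\<close> with the
  ambient operator \<open>P A P\<close>, where \<open>P = proj B\<close>; this carries the matrix
  function over to the setting of \<open>krylov_compression\<close>.\<close>

lemma sandwich_mat_op:
  assumes "A \<in> carrier_mat n n" "dim_row B = n" "orthonormal_cols B"
  shows "op.papp (\<lambda>x. proj B (mat_op A (proj B x))) r (mat_op B z)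
    = mat_op B (op.papp (mat_op (compression A B)) r z)"
  by (rule op.papp_intertwine[OF op.lin_op_sandwich[OF lin_mat_op lin_proj] lin_mat_op lin_mat_op])
    (simp add: proj_mat_op assms(3) mat_op_compression[OF assms(1,2)], simp add: proj_def)

lemma
  assumes A: "A \<in> carrier_mat n n" "hermitian_mat A" and B: "dim_row B = n" "orthonormal_cols B"
    and f: "ratio_on_spectrum f p q (compression A B)"
  defines "H \<equiv> \<lambda>x. proj B (mat_op A (proj B x))"
  shows projected_fun_ex:
      "\<exists>u. proj B u = u \<and> op.papp H q u = proj B x \<and> op.papp H p u = projected_fun f A B x"
    and sandwich_denom_inj: "proj B x = x \<Longrightarrow> op.papp H q x = 0 \<Longrightarrow> x = 0"
proof -
  let ?N = "compression A B"
  have N: "?N \<in> carrier_mat (dim_col B) (dim_col B)" "hermitian_mat ?N"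
    using A B by (auto intro: hermitian_compression)
  have sup: "supported (dim_col B) (mat_op (mat_adjoint B) x)" for x
    using supported_mat_op[of "mat_adjoint B" x] by simp
  note H = sandwich_mat_op[OF A(1) B, folded H_def]
  obtain u where u: "op.papp (mat_op ?N) q u = mat_op (mat_adjoint B) x"
      "op.papp (mat_op ?N) p u = mat_op (mat_fun f ?N) (mat_op (mat_adjoint B) x)"
    using mat_fun_rational_ex[OF N f sup] by blast
  show "\<exists>u. proj B u = u \<and> op.papp H q u = proj B x \<and> op.papp H p u = projected_fun f A B x"
    by (rule exI[of _ "mat_op B u"]) (use proj_mat_op[OF B(2), of u] in \<open>simp add: H u projected_fun_def proj_def\<close>)
  assume x: "proj B x = x" "op.papp H q x = 0"
  let ?z = "mat_op (mat_adjoint B) x"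
  have "mat_op B (op.papp (mat_op ?N) q ?z) = 0"
    using x H[of q ?z] by (simp add: proj_def)
  then have "mat_op (1\<^sub>m (dim_col B)) (op.papp (mat_op ?N) q ?z) = 0"
    using adjoint_mat_op_cancel[OF B(2), of "op.papp (mat_op ?N) q ?z"]
    by (simp only: op.lin_op_0[OF lin_mat_op])
  then have "op.papp (mat_op ?N) q ?z = 0"
    using mat_op_one[OF supported_papp[OF N(1) sup]] by simp
  then have "?z = 0" by (rule papp_denom_inj[OF N f sup])
  then show "x = 0" using x(1) by (simp only: proj_def op.lin_op_0[OF lin_mat_op])
qed

section \<open>Concatenation of column blocks\<close>

lemma append_cols_dim [simp]:
  "dim_row (append_cols X Y) = dim_row X" "dim_col (append_cols X Y) = dim_col X + dim_col Y"
  by (simp_all add: append_cols_def)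

lemma append_cols_index:
  "dim_row Y = dim_row X \<Longrightarrow> i < dim_row X \<Longrightarrow> j < dim_col X + dim_col Y \<Longrightarrow>
    append_cols X Y $$ (i, j) = (if j < dim_col X then X $$ (i, j) else Y $$ (i, j - dim_col X))"
  by (auto simp: append_cols_def mat_of_cols_def nth_append)

lemma sum_lessThan_add: "(\<Sum>j<a + b. g j) = (\<Sum>j<a. g j) + (\<Sum>j<b. g (a + j :: nat))" for g :: "nat \<Rightarrow> complex"
  by (induction b) (auto simp: add.assoc)

lemma mat_op_append_cols:
  assumes "dim_row Y = dim_row X"
  shows "mat_op (append_cols X Y) z = mat_op X z + mat_op Y (\<lambda>j. z (dim_col X + j))"
  using assms by (auto simp: mat_op_def fun_eq_iff append_cols_index sum_lessThan_add)

lemma mat_op_adjoint_append_cols: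
  assumes "dim_row Y = dim_row X"
  shows "mat_op (mat_adjoint (append_cols X Y)) x
    = (\<lambda>j. if j < dim_col X then mat_op (mat_adjoint X) x j else mat_op (mat_adjoint Y) x (j - dim_col X))"
  using assms by (auto simp: mat_op_def fun_eq_iff append_cols_index mat_adjoint_index)

lemma proj_append_cols:
  assumes "dim_row Y = dim_row X"
  shows "proj (append_cols X Y) x = proj X x + proj Y x"
proof -
  have "mat_op X (mat_op (mat_adjoint (append_cols X Y)) x) = proj X x"
    unfolding proj_def by (rule mat_op_cong) (simp add: mat_op_adjoint_append_cols[OF assms])
  moreover have "mat_op Y (\<lambda>j. mat_op (mat_adjoint (append_cols X Y)) x (dim_col X + j)) = proj Y x"
    unfolding proj_def by (rule mat_op_cong) (simp add: mat_op_adjoint_append_cols[OF assms])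
  ultimately show ?thesis
    unfolding proj_def[of "append_cols X Y"] mat_op_append_cols[OF assms] by simp
qed

lemma orthonormal_colsI:
  assumes "\<And>z. mat_op (mat_adjoint B) (mat_op B z) = mat_op (1\<^sub>m (dim_col B)) z"
  shows "orthonormal_cols B"
  unfolding orthonormal_cols_def
  by (rule mat_op_inj) (simp_all add: mat_op_mult assms)

lemma mat_op_one_eq: "mat_op (1\<^sub>m n) x = (\<lambda>i. if i < n then x i else 0)"
  using mat_op_one_apply[of _ n x] by (auto simp: mat_op_def fun_eq_iff)

lemma orthonormal_append_cols:
  assumes XY: "dim_row Y = dim_row X" and X: "orthonormal_cols X" and Y: "orthonormal_cols Y"
    and orth: "\<And>z. mat_op (mat_adjoint X) (mat_op Y z) = 0" "\<And>z. mat_op (mat_adjoint Y) (mat_op X z) = 0"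
  shows "orthonormal_cols (append_cols X Y)"
proof (rule orthonormal_colsI)
  fix z :: "nat \<Rightarrow> complex"
  let ?z = "\<lambda>j. z (dim_col X + j)"
  have "mat_op (mat_adjoint X) (mat_op (append_cols X Y) z) = mat_op (1\<^sub>m (dim_col X)) z"
    "mat_op (mat_adjoint Y) (mat_op (append_cols X Y) z) = mat_op (1\<^sub>m (dim_col Y)) ?z"
    unfolding mat_op_append_cols[OF XY] op.lin_op_add[OF lin_mat_op] orth
      adjoint_mat_op_cancel[OF X] adjoint_mat_op_cancel[OF Y] by simp_all
  then show "mat_op (mat_adjoint (append_cols X Y)) (mat_op (append_cols X Y) z)
      = mat_op (1\<^sub>m (dim_col (append_cols X Y))) z"
    unfolding mat_op_adjoint_append_cols[OF XY]
    by (intro ext) (auto simp: mat_op_one_eq)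
qed

lemma orthonormal_mult:
  assumes "orthonormal_cols X" "orthonormal_cols U" "dim_col X = dim_row U"
  shows "orthonormal_cols (X * U)"
proof (rule orthonormal_colsI)
  fix z :: "nat \<Rightarrow> complex"
  have "mat_op (mat_adjoint (X * U)) (mat_op (X * U) z)
      = mat_op (mat_adjoint U) (mat_op (mat_adjoint X) (mat_op X (mat_op U z)))"
    using assms(3) by (simp add: mat_adjoint_mult mat_op_mult)
  also have "\<dots> = mat_op (mat_adjoint U) (mat_op U z)"
    using assms(3) by (simp add: adjoint_mat_op_cancel[OF assms(1)] mat_op_one')
  finally show "mat_op (mat_adjoint (X * U)) (mat_op (X * U) z) = mat_op (1\<^sub>m (dim_col (X * U))) z"
    by (simp add: adjoint_mat_op_cancel[OF assms(2)])
qed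

text \<open>\<open>krylov_compression\<close> for the projections onto the columns of
  \<open>X\<close>, \<open>Y\<close> and \<open>X * U\<close>. Both \<open>c\<close> and
  \<open>\<kappa>\<close> are given in coordinates of \<open>X\<close>, so their ambient versions
  are \<open>mat_op X c\<close> and \<open>mat_op X \<kappa>\<close>.\<close>

theorem projected_fun_split:
  assumes A: "A \<in> carrier_mat n n" "hermitian_mat A"
    and X: "dim_row X = n" "orthonormal_cols X" and Y: "dim_row Y = n" "orthonormal_cols Y"
    and U: "dim_row U = dim_col X" "orthonormal_cols U"
    and orth: "\<And>z. mat_op (mat_adjoint X) (mat_op Y z) = 0" "\<And>z. mat_op (mat_adjoint Y) (mat_op X z) = 0"
    and coupling: "\<And>z. mat_op (mat_adjoint X) (mat_op A (mat_op Y z)) = scale_fun (z 0) c"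
    and Y0: "0 < dim_col Y"
    and k: "0 < k" and q: "deg_less q (Suc k)" and p: "deg_less p k" and real: "map_poly cnj q = q"
    and \<kappa>: "op.papp (mat_op (compression A X)) q \<kappa> = c"
    and krylov: "\<And>r. deg_less r k \<Longrightarrow> \<exists>z. op.papp (mat_op (compression A X)) r \<kappa> = mat_op U z"
    and fX: "ratio_on_spectrum f p q (compression A X)"
    and fK: "ratio_on_spectrum f p q (compression A (X * U))"
    and fZ: "ratio_on_spectrum f p q (compression A (append_cols X Y))"
    and fW: "ratio_on_spectrum f p q (compression A (append_cols (X * U) Y))"
    and v: "proj X v = v"
  shows "projected_fun f A (append_cols X Y) v
    = projected_fun f A X v - projected_fun f A (X * U) v + projected_fun f A (append_cols (X * U) Y) v"
proof -
  let ?Z = "append_cols X Y" and ?K = "X * U" and ?W = "append_cols (X * U) Y"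
  have K: "dim_row ?K = n" "orthonormal_cols ?K" using X U by (auto intro: orthonormal_mult)
  have Kop: "mat_op ?K z = mat_op X (mat_op U z)" for z using U(1) by (simp add: mat_op_mult)
  have Kadj: "mat_op (mat_adjoint ?K) z = mat_op (mat_adjoint U) (mat_op (mat_adjoint X) z)" for z
    using U(1) by (simp add: mat_op_mult mat_adjoint_mult)
  have zero: "mat_op N 0 = 0" for N by (rule op.lin_op_0[OF lin_mat_op])
  have Z: "dim_row ?Z = n" "orthonormal_cols ?Z"
    using X Y orth by (auto intro!: orthonormal_append_cols)
  have W: "dim_row ?W = n" "orthonormal_cols ?W"
    using K Y by (auto intro!: orthonormal_append_cols simp only: Kadj Kop orth zero append_cols_dim)
  have pZ: "proj ?Z = (\<lambda>x. proj X x + proj Y x)" and pW: "proj ?W = (\<lambda>x. proj ?K x + proj Y x)"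
    using X Y K by (simp_all add: proj_append_cols fun_eq_iff)
  note [simp del] = index_mult_mat
  have XY: "proj X (proj Y x) = 0" and YX: "proj Y (proj X x) = 0" for x
    unfolding proj_def by (simp_all only: orth zero)
  have Xc: "mat_op X (mat_op (1\<^sub>m (dim_col X)) z) = mat_op X z" for z by (simp add: mat_op_one')
  have KX: "proj ?K (proj X x) = proj ?K x" for x
    unfolding proj_def Kadj adjoint_mat_op_cancel[OF X(2)] using U(1)
    by (metis mat_adjoint_dim(2) mat_op_one mat_adjoint_dim(1) supported_mat_op)
  have XK: "proj X (proj ?K x) = proj ?K x" for x
    unfolding proj_def[of ?K] Kop by (rule proj_mat_op[OF X(2)])
  have definite: "proj Y x = 0" if "dot n (proj Y x) (proj Y x) = 0" for x
    using dot_self_eq_0[OF that] supported_proj[of Y x] Y(1) by simp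
  \<comment> \<open>\<open>e\<close> is the first column of \<open>Y\<close>; pairing with it reads
    off entry 0 of the coordinates in \<open>Y\<close>, the only entry that enters the
    coupling.\<close>
  define unit :: "nat \<Rightarrow> complex" where "unit = (\<lambda>j. if j = 0 then 1 else 0)"
  define e where "e = mat_op Y unit"
  have e: "proj Y e = e" unfolding e_def by (rule proj_mat_op[OF Y(2)])
  have dot_e: "dot n y e = mat_op (mat_adjoint Y) y 0" for y
  proof -
    have "dot n y e = dot (dim_col Y) (mat_op (mat_adjoint Y) y) unit"
      using dot_adjoint[of "mat_adjoint Y" y unit] Y(1) by (simp add: mat_adjoint_adjoint e_def)
    then show ?thesis using Y0 by (simp add: dot_def unit_def if_distrib[of "\<lambda>a. _ * a"] if_distrib[of cnj] cong: if_cong)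
  qed
  have c: "proj X (mat_op A (proj Y y)) = scale_fun (dot n y e) (mat_op X c)" for y
    unfolding proj_def coupling dot_e op.lin_op_scale[OF lin_mat_op] ..
  have XS: "op.papp (\<lambda>x. proj X (mat_op A (proj X x))) r (mat_op X \<kappa>)
      = mat_op X (op.papp (mat_op (compression A X)) r \<kappa>)" for r
    by (rule sandwich_mat_op[OF A(1) X])
  have kr: "proj ?K (op.papp (\<lambda>x. proj X (mat_op A (proj X x))) r (mat_op X \<kappa>))
      = op.papp (\<lambda>x. proj X (mat_op A (proj X x))) r (mat_op X \<kappa>)" if r: "deg_less r k" for r
  proof -
    obtain z where "op.papp (mat_op (compression A X)) r \<kappa> = mat_op U z" using krylov[OF r] by blast
    then show ?thesis unfolding XS using proj_mat_op[OF K(2), of z] by (simp only: Kop)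
  qed
  note ex = projected_fun_ex[OF A]
  have Yv: "proj Y v = 0" using YX[of v] v by simp
  have Zv: "proj ?Z v = v" and Wv: "proj ?W v = proj ?K v" unfolding pZ pW using v Yv by simp_all
  obtain u where u: "proj ?Z u = u" "op.papp (\<lambda>x. proj ?Z (mat_op A (proj ?Z x))) q u = v"
      "op.papp (\<lambda>x. proj ?Z (mat_op A (proj ?Z x))) p u = projected_fun f A ?Z v"
    using ex[OF Z fZ, of v] Zv by auto
  obtain uc where uc: "proj ?W uc = uc" "op.papp (\<lambda>x. proj ?W (mat_op A (proj ?W x))) q uc = proj ?K v"
      "op.papp (\<lambda>x. proj ?W (mat_op A (proj ?W x))) p uc = projected_fun f A ?W v"
    using ex[OF W fW, of v] Wv by auto
  obtain s where s: "proj X s = s" "op.papp (\<lambda>x. proj X (mat_op A (proj X x))) q s = v"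
      "op.papp (\<lambda>x. proj X (mat_op A (proj X x))) p s = projected_fun f A X v"
    using ex[OF X fX, of v] v by auto
  obtain t where t: "proj ?K t = t" "op.papp (\<lambda>x. proj ?K (mat_op A (proj ?K x))) q t = proj ?K v"
      "op.papp (\<lambda>x. proj ?K (mat_op A (proj ?K x))) p t = projected_fun f A ?K v"
    using ex[OF K fK, of v] by auto
  have surj: "\<exists>u. proj X u + proj Y u = u \<and>
      op.papp (\<lambda>x. proj X (mat_op A (proj X x + proj Y x)) + proj Y (mat_op A (proj X x + proj Y x))) q u = y"
    if y: "proj Y y = y" for y
  proof -
    have "proj ?Z y = y" unfolding pZ using y XY[of y] by simp
    then show ?thesis using ex[OF Z fZ, of y] unfolding pZ by auto
  qed
  have "projected_fun f A ?Z v - projected_fun f A X v = projected_fun f A ?W v - projected_fun f A ?K v"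
    unfolding u(3)[symmetric] uc(3)[symmetric] s(3)[symmetric] t(3)[symmetric] pZ pW
    by (rule op.krylov_compression[where n = n and e = e and c = "mat_op X c" and q = q and k = k
          and \<kappa> = "mat_op X \<kappa>" and v = v])
      (use selfadj_mat_op[OF A] selfadj_proj[OF X(1)] selfadj_proj[OF Y(1)] selfadj_proj[OF K(1)]
        proj_idem[OF X(2)] proj_idem[OF Y(2)] proj_idem[OF K(2)] XY YX KX XK definite c e k q p real
        proj_mat_op[OF X(2)] XS \<kappa> kr surj sandwich_denom_inj[OF A X fX] sandwich_denom_inj[OF A K fK] v
        u(1,2)[unfolded pZ] uc(1,2)[unfolded pW] s(1,2) t(1,2) in \<open>simp_all only:\<close>)
  then show ?thesis by (simp add: algebra_simps)
qed

section \<open>Rational Krylov spaces\<close>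

lemma vec_fun_zero: "vec_fun (0\<^sub>v n) = 0"
  by (simp add: vec_fun_def fun_eq_iff)

lemma vec_fun_smult: "vec_fun (z \<cdot>\<^sub>v x) = scale_fun z (vec_fun x)"
  by (auto simp: vec_fun_def scale_fun_def fun_eq_iff)

lemma papp_linear_factor:
  "op.papp (mat_op N) [:-z, 1:] y = mat_op N y - scale_fun z y"
proof -
  have "op.papp (mat_op N) [:-z, 1:] y = scale_fun (- z) y + mat_op N y"
    by (simp only: op.papp_pCons[OF lin_mat_op] op.papp_0 op.lin_op_0[OF lin_mat_op] op.scale_one add_0_right)
  then show ?thesis by (simp add: fun_eq_iff scale_fun_def)
qed

text \<open>Remove one factor at a time: a nonzero vector killed by the factor of a finite pole
  \<open>z\<close> would be an eigenvector for \<open>z\<close>, and an infinite pole contributes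
  the factor 1.\<close>

lemma papp_pole_poly_inj:
  assumes N: "N \<in> carrier_mat n n" and x: "supported n x" and \<zeta>: "poles_avoid_spectrum \<zeta> N"
    and 0: "op.papp (mat_op N) (pole_poly \<zeta>) x = 0"
  shows "x = 0"
  using \<zeta> 0
proof (induction \<zeta>)
  case Nil
  then show ?case by (simp add: pole_poly_def op.papp_1[OF lin_mat_op])
next
  case (Cons t \<zeta>)
  let ?y = "op.papp (mat_op N) (pole_poly \<zeta>) x"
  have avoid: "poles_avoid_spectrum \<zeta> N" using Cons.prems(1) by (simp add: poles_avoid_spectrum_def)
  have "?y = 0"
  proof (cases t)
    case None
    then have "pole_poly (t # \<zeta>) = pole_poly \<zeta>" by (simp add: pole_poly_def)
    then show ?thesis using Cons.prems(2) by (simp only:)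
  next
    case (Some z)
    have sup: "supported n ?y" by (rule supported_papp[OF N x])
    then obtain g where g: "g \<in> carrier_vec n" "vec_fun g = ?y" using vec_fun_surj by blast
    have "pole_poly (t # \<zeta>) = [:-z, 1:] * pole_poly \<zeta>" by (simp add: Some pole_poly_def)
    then have "op.papp (mat_op N) [:-z, 1:] ?y = 0"
      using Cons.prems(2) by (simp only: op.papp_mult[OF lin_mat_op])
    then have "mat_op N ?y = scale_fun z ?y"
      unfolding papp_linear_factor by (rule eq_iff_diff_eq_0[THEN iffD2])
    then have "vec_fun (N *\<^sub>v g) = vec_fun (z \<cdot>\<^sub>v g)"
      using g N by (simp add: vec_fun_mult vec_fun_smult)
    then have "N *\<^sub>v g = z \<cdot>\<^sub>v g"
      by (rule vec_fun_inj[rotated]) (use g N in auto)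
    moreover have "\<not> eigenvalue N z" using Cons.prems(1) Some by (simp add: poles_avoid_spectrum_def)
    ultimately have "g = 0\<^sub>v n" using g(1) N by (auto simp: eigenvalue_def eigenvector_def)
    then show ?thesis using g(2) by (simp add: vec_fun_zero)
  qed
  then show ?case by (rule Cons.IH[OF avoid])
qed

text \<open>Polynomials in \<open>N\<close> commute with the inverse of the denominator, so a
  rational Krylov space is a polynomial Krylov space started at this vector.\<close>

definition krylov_generator :: "complex mat \<Rightarrow> complex vec \<Rightarrow> pole list \<Rightarrow> complex vec" where
  "krylov_generator N c \<zeta> = the (mat_inverse (poly_mat (pole_poly \<zeta>) N)) *\<^sub>v c"

lemma
  assumes N: "N \<in> carrier_mat n n" and c: "c \<in> carrier_vec n" and \<zeta>: "poles_avoid_spectrum \<zeta> N"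
  shows papp_krylov_generator: 
      "op.papp (mat_op N) (pole_poly \<zeta>) (vec_fun (krylov_generator N c \<zeta>)) = vec_fun c"
    and rat_krylov_generator: "vec_fun ` rat_krylov N c \<zeta>
      = {op.papp (mat_op N) r (vec_fun (krylov_generator N c \<zeta>)) | r. degree r < length \<zeta>}"
proof -
  let ?P = "poly_mat (pole_poly \<zeta>) N" and ?\<kappa> = "krylov_generator N c \<zeta>"
  have P: "?P \<in> carrier_mat n n" using N by simp
  have inj: "x = y" if "supported n x" "supported n y"
      "op.papp (mat_op N) (pole_poly \<zeta>) x = op.papp (mat_op N) (pole_poly \<zeta>) y" for x y
  proof -
    have "supported n (x - y)" using that by (simp add: supported_def)
    moreover have "op.papp (mat_op N) (pole_poly \<zeta>) (x - y) = 0"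
      using that(3) by (simp only: op.lin_op_diff[OF op.lin_op_papp[OF lin_mat_op]] diff_self)
    ultimately have "x - y = 0" using papp_pole_poly_inj[OF N _ \<zeta>] by blast
    then show ?thesis by simp
  qed
  have "det ?P \<noteq> 0"
  proof
    assume "det ?P = 0"
    then obtain g where g: "g \<in> carrier_vec n" "g \<noteq> 0\<^sub>v n" "?P *\<^sub>v g = 0\<^sub>v n"
      using det_0_iff_vec_prod_zero_field[OF P] by blast
    have "op.papp (mat_op N) (pole_poly \<zeta>) (vec_fun g) = 0"
      using vec_fun_poly_mat[OF N g(1), of "pole_poly \<zeta>"] g(3) by (simp add: vec_fun_zero)
    then have "vec_fun g = 0"
      using papp_pole_poly_inj[OF N _ \<zeta>] supported_vec_fun[of g] g(1) by simp
    then have "g = 0\<^sub>v n" using g(1) by (intro vec_fun_inj) (auto simp: vec_fun_zero)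
    with g(2) show False by simp
  qed
  then have "mat_inverse ?P \<noteq> None"
    using mat_inverse(1)[OF P, where b = "()"] det_non_zero_imp_unit[OF P, where b = "()"] by blast
  then obtain B where B: "mat_inverse ?P = Some B" by blast
  have PB: "?P * B = 1\<^sub>m n" "B \<in> carrier_mat n n" using mat_inverse(2)[OF P B] by auto
  have P_inv: "op.papp (mat_op N) (pole_poly \<zeta>) (vec_fun (B *\<^sub>v x)) = vec_fun x" if x: "x \<in> carrier_vec n" for x
  proof -
    have "?P *\<^sub>v (B *\<^sub>v x) = x"
      using assoc_mult_mat_vec[OF P PB(2) x] PB(1) x by simp
    then show ?thesis using vec_fun_poly_mat[OF N, of "B *\<^sub>v x" "pole_poly \<zeta>"] PB(2) x by simp
  qed
  have \<kappa>: "?\<kappa> = B *\<^sub>v c" by (simp add: krylov_generator_def B)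
  show gen: "op.papp (mat_op N) (pole_poly \<zeta>) (vec_fun ?\<kappa>) = vec_fun c"
    unfolding \<kappa> by (rule P_inv[OF c])
  have sup\<kappa>: "supported n (vec_fun ?\<kappa>)"
    using supported_vec_fun[of ?\<kappa>] PB(2) by (simp add: \<kappa>)
  \<comment> \<open>Both sides have the same image under the injective
    \<open>pole_poly \<zeta>\<close> of \<open>N\<close>; this stands in for commuting
    \<open>B\<close> with \<open>poly_mat r N\<close>.\<close>
  have "vec_fun (B *\<^sub>v (poly_mat r N *\<^sub>v c)) = op.papp (mat_op N) r (vec_fun ?\<kappa>)" for r
  proof (rule inj)
    show "supported n (vec_fun (B *\<^sub>v (poly_mat r N *\<^sub>v c)))"
      using supported_vec_fun[of "B *\<^sub>v (poly_mat r N *\<^sub>v c)"] PB(2) by simp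
    show "supported n (op.papp (mat_op N) r (vec_fun ?\<kappa>))" by (rule supported_papp[OF N sup\<kappa>])
    have "poly_mat r N *\<^sub>v c \<in> carrier_vec n" using N c by (metis mult_mat_vec_carrier poly_mat_carrier)
    then have "op.papp (mat_op N) (pole_poly \<zeta>) (vec_fun (B *\<^sub>v (poly_mat r N *\<^sub>v c)))
        = op.papp (mat_op N) r (vec_fun c)"
      by (simp only: P_inv vec_fun_poly_mat[OF N c])
    also have "\<dots> = op.papp (mat_op N) (pole_poly \<zeta>) (op.papp (mat_op N) r (vec_fun ?\<kappa>))"
      unfolding gen[symmetric] by (rule op.papp_commute[OF lin_mat_op])
    finally show "op.papp (mat_op N) (pole_poly \<zeta>) (vec_fun (B *\<^sub>v (poly_mat r N *\<^sub>v c)))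
        = op.papp (mat_op N) (pole_poly \<zeta>) (op.papp (mat_op N) r (vec_fun ?\<kappa>))" .
  qed
  then show "vec_fun ` rat_krylov N c \<zeta> = {op.papp (mat_op N) r (vec_fun ?\<kappa>) | r. degree r < length \<zeta>}"
    unfolding rat_krylov_def B option.sel by (auto simp: image_def)
qed

text \<open>An infinite pole leaves the denominator and hence the generator unchanged but raises the
  admissible degree by one. The block tridiagonal structure comes from this.\<close>

lemma rat_krylov_extend_infinity:
  assumes N: "N \<in> carrier_mat n n" and c: "c \<in> carrier_vec n" and \<zeta>: "poles_avoid_spectrum \<zeta> N"
    and x: "x \<in> vec_fun ` rat_krylov N c \<zeta>"
  shows "mat_op N x \<in> vec_fun ` rat_krylov N c (\<zeta> @ [None])"
proof -
  have \<zeta>': "poles_avoid_spectrum (\<zeta> @ [None]) N" using \<zeta> by (simp add: poles_avoid_spectrum_def)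
  have g: "krylov_generator N c (\<zeta> @ [None]) = krylov_generator N c \<zeta>"
    by (simp add: krylov_generator_def pole_poly_def)
  obtain r where r: "degree r < length \<zeta>" "x = op.papp (mat_op N) r (vec_fun (krylov_generator N c \<zeta>))"
    using x unfolding rat_krylov_generator[OF N c \<zeta>] by blast
  have "mat_op N x = op.papp (mat_op N) (pCons 0 r) (vec_fun (krylov_generator N c \<zeta>))"
    unfolding r(2) op.papp_pCons[OF lin_mat_op] by simp
  moreover have "degree (pCons 0 r) < Suc (length \<zeta>)"
    using r(1) degree_pCons_le[of 0 r] by linarith
  ultimately show ?thesis
    unfolding rat_krylov_generator[OF N c \<zeta>'] g by auto
qed

lemma is_onb_range:
  assumes "is_onb n X K"
  shows "vec_fun ` K = range (mat_op X)"
proof -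
  have X: "X \<in> carrier_mat n (dim_col X)" and K: "K = vec_space.col_space n X"
    using assms by (auto simp: is_onb_def)
  have K': "K = {y \<in> carrier_vec (dim_row X). \<exists>x\<in>carrier_vec (dim_col X). X *\<^sub>v x = y}"
    unfolding K by (rule vec_space.col_space_eq[OF X])
  show ?thesis
  proof (intro equalityI subsetI)
    fix y assume "y \<in> vec_fun ` K"
    then show "y \<in> range (mat_op X)" unfolding K' by (auto simp: vec_fun_mult)
  next
    fix y assume "y \<in> range (mat_op X)"
    then obtain z where z: "y = mat_op X z" by blast
    let ?x = "vec (dim_col X) z"
    have "y = mat_op X (vec_fun ?x)" unfolding z by (rule mat_op_cong) (simp add: vec_fun_def)
    also have "\<dots> = vec_fun (X *\<^sub>v ?x)" by (simp add: vec_fun_mult)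
    finally show "y \<in> vec_fun ` K"
      unfolding K' by (intro image_eqI CollectI conjI bexI[of _ ?x] carrier_vecI) simp_all
  qed
qed

section \<open>Reduction to a real denominator\<close>

lemma map_poly_cnj_mult: "map_poly cnj (r * r') = map_poly cnj r * map_poly cnj r'"
  by (rule poly_eqI) (simp add: coeff_map_poly coeff_mult cnj_sum)

lemma map_poly_cnj_prod_mset:
  "map_poly cnj (\<Prod>z\<in>#R. [:-z, 1:]) = (\<Prod>z\<in>#image_mset cnj R. [:-z, 1:])"
proof (induction R)
  case (add z R)
  have "map_poly cnj [:-z, 1:] = [:-cnj z, 1:]" by (simp add: map_poly_cnj_pCons)
  then show ?case
    by (simp only: image_mset_add_mset prod_mset.add_mset map_poly_cnj_mult add.IH)
qed (simp add: map_poly_cnj_pCons flip: pCons_one)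

text \<open>\<open>h\<close> collects the common roots and also takes the leading coefficient of
  \<open>q\<close>. Then \<open>q'\<close> is monic with exactly the poles of the fraction as roots,
  so closure under conjugation makes its coefficients real.\<close>

lemma real_denominator:
  assumes "p \<noteq> 0" "q \<noteq> 0" "conj_closed (rat_poles p q)"
  obtains p' q' h where "p = p' * h" "q = q' * h" "map_poly cnj q' = q'"
proof
  let ?L = "\<lambda>R :: complex multiset. \<Prod>z\<in>#R. [:-z, 1:]"
  let ?h = "?L (proots q \<inter># proots p)" and ?q = "?L (proots q - proots p)"
  have split: "smult (lead_coeff r) (?L (R - R')) * ?L (R \<inter># R') = r"
    if "R = proots r" for r :: "complex poly" and R R'
  proof -
    have "?L (R - R') * ?L (R \<inter># R') = ?L (R - R' + R \<inter># R')" by simp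
    also have "R - R' + R \<inter># R' = R" by (rule multiset_eqI) simp
    finally show ?thesis using complex_poly_decompose_multiset[of r] that by simp
  qed
  show "q = ?q * smult (lead_coeff q) ?h"
    using split[of "proots q" q "proots p"] by (simp only: mult_smult_right mult_smult_left)
  have comm: "proots p \<inter># proots q = proots q \<inter># proots p"
    by (rule multiset_eqI) (simp add: min.commute)
  have "p = smult (lead_coeff p) (?L (proots p - proots q)) * ?h"
    using split[of "proots p" p "proots q"] by (simp only: comm)
  then show "p = smult (lead_coeff p / lead_coeff q) (?L (proots p - proots q)) * smult (lead_coeff q) ?h"
    using assms(2) by simp
  show "map_poly cnj ?q = ?q"
    unfolding map_poly_cnj_prod_mset using assms by (simp add: conj_closed_def rat_poles_def)
qed

lemma pole_poly_mset:
  assumes "mset \<xi> = image_mset Some R + replicate_mset l None"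
  shows "pole_poly \<xi> = (\<Prod>z\<in>#R. [:-z, 1:])"
proof -
  have "pole_poly \<xi> = (\<Prod>t\<in>#mset \<xi>. case t of None \<Rightarrow> 1 | Some z \<Rightarrow> [:-z, 1:])"
    unfolding pole_poly_def by (metis mset_map prod_mset_prod_list)
  also have "\<dots> = (\<Prod>z\<in>#R. [:-z, 1:])"
    unfolding assms by (simp add: image_mset.compositionality comp_def)
  finally show ?thesis .
qed

text \<open>Common factors \<open>h\<close> of numerator and denominator need not have conjugation closed roots, but the
  space with the poles of \<open>q = q' * h\<close> contains the one with the poles of \<open>q'\<close>.\<close>

lemma krylov_reduced_generator:
  assumes N: "N \<in> carrier_mat n n" and c: "c \<in> carrier_vec n" and \<xi>: "poles_avoid_spectrum \<xi> N"
    and q: "q \<noteq> 0" "degree q \<le> k" "q = q' * h"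
    and mset: "mset \<xi> = image_mset Some (proots q) + replicate_mset (k - degree q) None"
    and U: "is_onb n U (rat_krylov N c \<xi>)" and h: "degree h < k"
  shows "\<exists>\<kappa>. op.papp (mat_op N) q' \<kappa> = vec_fun c \<and>
    (\<forall>r. deg_less r (k - degree h) \<longrightarrow> (\<exists>z. op.papp (mat_op N) r \<kappa> = mat_op U z))"
proof -
  let ?\<kappa> = "vec_fun (krylov_generator N c \<xi>)"
  have len: "length \<xi> = k"
    using arg_cong[OF mset, of size] q(2) by (simp add: size_proots_complex)
  have qp: "smult (lead_coeff q) (pole_poly \<xi>) = q"
    unfolding pole_poly_mset[OF mset] by (rule complex_poly_decompose_multiset)
  \<comment> \<open>\<open>pole_poly \<xi>\<close> is \<open>q\<close> made monic. Applying
    \<open>?a * h\<close> to the generator for \<open>\<xi>\<close> therefore gives a solution for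
    \<open>q'\<close>, and multiplying by \<open>h\<close> uses up \<open>degree h\<close> of the
    \<open>k\<close> degrees that \<open>U\<close> covers.\<close>
  let ?a = "1 / lead_coeff q"
  have "op.papp (mat_op N) q' (op.papp (mat_op N) (smult ?a h) ?\<kappa>) = op.papp (mat_op N) (smult ?a q) ?\<kappa>"
    by (simp only: op.papp_mult[OF lin_mat_op, symmetric] q(3) mult_smult_right)
  also have "smult ?a q = pole_poly \<xi>" by (subst qp[symmetric]) (use q(1) in simp)
  finally have 1: "op.papp (mat_op N) q' (op.papp (mat_op N) (smult ?a h) ?\<kappa>) = vec_fun c"
    by (simp only: papp_krylov_generator[OF N c \<xi>])
  have 2: "\<exists>z. op.papp (mat_op N) r (op.papp (mat_op N) (smult ?a h) ?\<kappa>) = mat_op U z"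
    if r: "deg_less r (k - degree h)" for r
  proof -
    have "degree r < k - degree h" using r h by (simp add: deg_less_iff)
    moreover have "degree (r * smult ?a h) \<le> degree r + degree h"
      using degree_mult_le[of r "smult ?a h"] degree_smult_le[of ?a h] by linarith
    ultimately have "degree (r * smult ?a h) < length \<xi>" using len by linarith
    then have "op.papp (mat_op N) (r * smult ?a h) ?\<kappa> \<in> range (mat_op U)"
      unfolding is_onb_range[OF U, symmetric] rat_krylov_generator[OF N c \<xi>] by blast
    then show ?thesis unfolding op.papp_mult[OF lin_mat_op] by blast
  qed
  from 1 2 show ?thesis by blast
qed

section \<open>The compressed rational Lanczos algorithm\<close>

lemma col_range_dim [simp]: "dim_row (col_range Q a c) = dim_row Q" "dim_col (col_range Q a c) = c - a"
  by (simp_all add: col_range_def)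

lemma col_range_index: "i < dim_row Q \<Longrightarrow> j < c - a \<Longrightarrow> col_range Q a c $$ (i, j) = Q $$ (i, a + j)"
  by (simp add: col_range_def)

lemma sum_shift_window:
  fixes g :: "nat \<Rightarrow> complex"
  assumes "c \<le> M"
  shows "(\<Sum>j<M. g j * (if a \<le> j \<and> j < c then z (j - a) else 0)) = (\<Sum>j<c - a. g (a + j) * z j)"
proof -
  have "(\<Sum>j<M. g j * (if a \<le> j \<and> j < c then z (j - a) else 0)) = (\<Sum>j\<in>{a..<c}. g j * z (j - a))"
    using assms by (intro sum.mono_neutral_cong_right) auto
  also have "\<dots> = (\<Sum>j<c - a. g (a + j) * z j)"
    by (rule sum.reindex_bij_witness[of _ "\<lambda>j. a + j" "\<lambda>j. j - a"]) auto
  finally show ?thesis .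
qed

lemma mat_op_col_range:
  assumes "c \<le> dim_col Q"
  shows "mat_op (col_range Q a c) z = mat_op Q (\<lambda>j. if a \<le> j \<and> j < c then z (j - a) else 0)"
proof
  fix i
  show "mat_op (col_range Q a c) z i = mat_op Q (\<lambda>j. if a \<le> j \<and> j < c then z (j - a) else 0) i"
    using sum_shift_window[OF assms, of "\<lambda>j. Q $$ (i, j)" a z] by (simp add: mat_op_def col_range_index)
qed

lemma mat_op_adjoint_col_range:
  assumes "c \<le> dim_col Q"
  shows "mat_op (mat_adjoint (col_range Q a c)) x = (\<lambda>j. if j < c - a then mat_op (mat_adjoint Q) x (a + j) else 0)"
  using assms by (auto simp: mat_op_def fun_eq_iff col_range_index mat_adjoint_index)

lemma mat_op_adjoint_col_range_col_range:
  assumes "orthonormal_cols Q" "c \<le> dim_col Q" "c' \<le> dim_col Q"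
  shows "mat_op (mat_adjoint (col_range Q a c)) (mat_op (col_range Q a' c') z)
    = (\<lambda>j. if j < c - a \<and> a' \<le> a + j \<and> a + j < c' then z (a + j - a') else 0)"
  unfolding mat_op_adjoint_col_range[OF assms(2)] mat_op_col_range[OF assms(3)]
    adjoint_mat_op_cancel[OF assms(1)] mat_op_one_eq
  using assms(2) by (auto simp: fun_eq_iff)

lemma orthonormal_col_range:
  assumes "orthonormal_cols Q" "c \<le> dim_col Q"
  shows "orthonormal_cols (col_range Q a c)"
  by (rule orthonormal_colsI)
    (auto simp: mat_op_adjoint_col_range_col_range[OF assms(1,2,2)] mat_op_one_eq fun_eq_iff)

text \<open>Handles the case \<open>j = i\<close> of \<open>[V_i Q_{i+1} ... Q_j]\<close>, where no
  block follows.\<close>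

lemma append_cols_empty: "dim_row Y = dim_row X \<Longrightarrow> dim_col Y = 0 \<Longrightarrow> append_cols X Y = X"
  by (rule eq_matI) (simp_all add: append_cols_index)

lemma append_cols_col_range:
  assumes X: "dim_row X = dim_row Q" and "a \<le> b" "b \<le> c"
  shows "append_cols (append_cols X (col_range Q a b)) (col_range Q b c) = append_cols X (col_range Q a c)"
proof -
  obtain d e where b: "b = a + d" and c: "c = a + d + e" using assms(2,3) by (metis le_Suc_ex)
  show ?thesis
  proof (rule eq_matI)
    fix i j
    assume "i < dim_row (append_cols X (col_range Q a c))" "j < dim_col (append_cols X (col_range Q a c))"
    then have i: "i < dim_row Q" and j: "j < dim_col X + d + e" using X c by auto
    consider "j < dim_col X" | t where "j = dim_col X + t" "t < d" | t where "j = dim_col X + d + t" "t < e"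
      using j by (metis add.assoc add_less_cancel_left le_Suc_ex not_le)
    then show "append_cols (append_cols X (col_range Q a b)) (col_range Q b c) $$ (i, j)
        = append_cols X (col_range Q a c) $$ (i, j)"
      using i X by cases (simp_all add: b c append_cols_index col_range_index add.assoc)
  qed (use X in \<open>simp_all add: b c\<close>)
qed

text \<open>With \<open>g = X^H T Y z\<close>, moving the operators across the inner product turns
  \<open><g, g>\<close> into \<open><z, Y^H T X g> = 0\<close>. Used for \<open>T = A\<close> and
  for the identity.\<close>

lemma adjoint_zero_sym:
  assumes T: "op.selfadj n T" and dims: "dim_row X = n" "dim_row Y = n"
    and 0: "\<And>z. mat_op (mat_adjoint Y) (T (mat_op X z)) = 0"
  shows "mat_op (mat_adjoint X) (T (mat_op Y z)) = 0"
proof (rule dot_self_eq_0)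
  let ?g = "mat_op (mat_adjoint X) (T (mat_op Y z))"
  show "supported (dim_col X) ?g" using supported_mat_op[of "mat_adjoint X"] by simp
  have "dot (dim_col X) ?g ?g = dot n (T (mat_op Y z)) (mat_op X ?g)"
    using dot_adjoint[of "mat_adjoint X" "T (mat_op Y z)" ?g] dims by (simp add: mat_adjoint_adjoint)
  also have "\<dots> = dot (dim_col Y) z (mat_op (mat_adjoint Y) (T (mat_op X ?g)))"
    using T dot_adjoint[of Y z "T (mat_op X ?g)"] dims by (simp add: op.selfadj_def)
  finally show "dot (dim_col X) ?g ?g = 0" unfolding 0 by (simp add: op.ip_0_right)
qed

lemma selfadj_ident: "op.selfadj n (\<lambda>x. x)"
  by (simp add: op.selfadj_def op.lin_op_def)

lemma outer_prod_dim [simp]: "dim_row (outer_prod x y) = dim_vec x" "dim_col (outer_prod x y) = dim_vec y"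
  by (simp_all add: outer_prod_def)

lemma mat_adjoint_outer_prod: "mat_adjoint (outer_prod x y) = outer_prod y x"
  by (rule eq_matI) (simp_all add: mat_adjoint_index, simp_all add: outer_prod_def)

lemma mat_op_outer_prod_unit:
  "0 < m \<Longrightarrow> mat_op (outer_prod x (unit_vec m 0)) z = scale_fun (z 0) (vec_fun x)"
  by (auto simp: mat_op_def outer_prod_def scale_fun_def vec_fun_def fun_eq_iff unit_vec_def
      if_distrib[of cnj] if_distrib[of "\<lambda>a. _ * a"] if_distrib[of "\<lambda>a. a * _"] cong: if_cong)

lemma four_block_compression:
  assumes A: "A \<in> carrier_mat n n" and X: "dim_row X = n" and Y: "dim_row Y = n"
  shows "compression A (append_cols X Y) = four_block_mat (compression A X) (mat_adjoint X * A * Y)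
    (mat_adjoint Y * A * X) (compression A Y)"
proof (rule mat_op_inj)
  fix z :: "nat \<Rightarrow> complex"
  let ?F = "four_block_mat (compression A X) (mat_adjoint X * A * Y) (mat_adjoint Y * A * X) (compression A Y)"
  let ?z = "\<lambda>j. z (dim_col X + j)"
  have "mat_op ?F z = (\<lambda>i. if i < dim_col X then (mat_op (compression A X) z + mat_op (mat_adjoint X * A * Y) ?z) i
      else (mat_op (mat_adjoint Y * A * X) z + mat_op (compression A Y) ?z) (i - dim_col X))"
    by (auto simp: mat_op_def fun_eq_iff sum_lessThan_add compression_def simp del: index_mult_mat(1))
  also have "\<dots> = mat_op (mat_adjoint (append_cols X Y)) (mat_op A (mat_op (append_cols X Y) z))"
    using A X Y
    by (simp add: mat_op_adjoint_append_cols mat_op_append_cols op.lin_op_add[OF lin_mat_op]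
        mat_op_compression[OF A] mat_op_mult fun_eq_iff)
  also have "\<dots> = mat_op (compression A (append_cols X Y)) z"
    using X by (simp add: mat_op_compression[OF A])
  finally show "mat_op (compression A (append_cols X Y)) z = mat_op ?F z" ..
qed (simp_all add: compression_def)

lemma compression_mult:
  assumes "A \<in> carrier_mat n n" "dim_row X = n" "dim_row U = dim_col X"
  shows "compression A (X * U) = compression (compression A X) U"
  by (rule mat_op_inj) (use assms in \<open>simp_all add: compression_def mat_op_mult mat_adjoint_mult\<close>)

lemma vec_fun_append:
  "vec_fun (x @\<^sub>v y) = (\<lambda>j. if j < dim_vec x then vec_fun x j else vec_fun y (j - dim_vec x))"
  by (auto simp: vec_fun_def fun_eq_iff)

lemma vec_fun_unit: "0 < d \<Longrightarrow> vec_fun (a \<cdot>\<^sub>v unit_vec d 0) = (\<lambda>j. if j = 0 then a else 0)"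
  by (auto simp: vec_fun_def fun_eq_iff unit_vec_def)

lemma mat_op_adjoint_range:
  "orthonormal_cols B \<Longrightarrow> x \<in> carrier_vec (dim_col B) \<Longrightarrow> mat_op (mat_adjoint B) (mat_op B (vec_fun x)) = vec_fun x"
  unfolding adjoint_mat_op_cancel using supported_vec_fun[of x] by (simp add: mat_op_one)

lemma projected_fun_vec:
  assumes "A \<in> carrier_mat n n" "hermitian_mat A" "dim_row B = n" "z \<in> carrier_vec (dim_col B)"
    and "mat_op (mat_adjoint B) x = vec_fun z"
  shows "vec_fun (B *\<^sub>v (mat_fun f (compression A B) *\<^sub>v z)) = projected_fun f A B x"
proof -
  have "mat_fun f (compression A B) \<in> carrier_mat (dim_col B) (dim_col B)"
    using assms by (intro mat_fun_carrier compression_carrier hermitian_compression)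
  then show ?thesis
    using assms(4,5) by (simp add: vec_fun_mult projected_fun_def)
qed

section \<open>Block structure and invariants of a run\<close>

locale rk_run =
  fixes A Q :: "complex mat" and b :: "complex vec" and n k m s :: nat
    and \<theta> \<xi> :: "pole list" and p q :: "complex poly" and f :: "complex \<Rightarrow> complex"
    and U V S :: "nat \<Rightarrow> complex mat" and v bt w y :: "nat \<Rightarrow> complex vec"
  assumes A: "A \<in> carrier_mat n n" and herm: "hermitian_mat A"
    and b: "b \<in> carrier_vec n"
    and k: "k > 0" and m: "m > 0" and s: "s > 0"
    and len: "length \<theta> = k + s * m"
    and inf: "\<And>i. i \<in> {1..s - 1} \<Longrightarrow> \<theta> ! (k + i * m) = None"
    and dp: "degree p \<le> k - 1" and dq: "degree q \<le> k" and q0: "q \<noteq> 0"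
    and cc: "conj_closed (rat_poles p q)"
    and f: "f = (\<lambda>x. poly p x / poly q x)"
    and \<xi>: "mset \<xi> = image_mset Some (proots q) + replicate_mset (k - degree q) None"
    and lanczos: "rat_lanczos_basis A b \<theta> Q"
    and run: "rk_compressed_lanczos f A b k m s \<xi> Q U V S v bt w y"
    and \<theta>_avoid: "poles_avoid_spectrum \<theta> A"
    and \<xi>_avoid: "\<And>i. i \<in> {1..s} \<Longrightarrow> poles_avoid_spectrum \<xi> (S i)"
    and denom: "denom_nonzero_on_projections q A k m s Q U V"
begin

abbreviation L :: "nat \<Rightarrow> nat" where "L i \<equiv> k + i * m"
abbreviation QQ :: "nat \<Rightarrow> nat \<Rightarrow> complex mat" where "QQ \<equiv> col_range Q"

lemma dim_col_Q: "dim_col Q = L s"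
  using lanczos len by (simp add: rat_lanczos_basis_def)

lemma onb: "l \<in> {1..L s} \<Longrightarrow> is_onb n (QQ 0 l) (rat_krylov A b (take l \<theta>))"
  using lanczos len A by (simp add: rat_lanczos_basis_def)

lemma dim_row_Q: "dim_row Q = n"
  using onb[of "L s"] k by (simp add: is_onb_def)

lemma Q_on: "orthonormal_cols Q"
proof -
  have "QQ 0 (L s) = Q" by (rule eq_matI) (simp_all add: col_range_def dim_col_Q)
  then show ?thesis using onb[of "L s"] k by (simp add: is_onb_def orthonormal_cols_def)
qed

lemma L_le: "i \<le> j \<Longrightarrow> L i \<le> L j" by simp
lemma L_less: "i < j \<Longrightarrow> L i < L j" using m by simp

lemma blocks_first: "blocks k m Q 1 j = QQ 0 (L j)"
  and blocks_later: "0 < i \<Longrightarrow> blocks k m Q (i + 1) j = QQ (L i) (L j)"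
  by (simp_all add: blocks_def)

lemma QQ_zero: "c \<le> L s \<Longrightarrow> c' \<le> L s \<Longrightarrow> c' \<le> a \<or> c \<le> a' \<Longrightarrow>
    mat_op (mat_adjoint (QQ a c)) (mat_op (QQ a' c') z) = 0"
  by (auto simp: mat_op_adjoint_col_range_col_range[OF Q_on] dim_col_Q fun_eq_iff)

text \<open>Counting from 0, entry \<open>L i\<close> of \<open>\<theta>\<close> is the pole
  appended when the basis grows from \<open>L i\<close> to \<open>L i + 1\<close> columns, and this
  pole is infinite.\<close>

lemma A_QQ:
  assumes i: "1 \<le> i" "i < s"
  shows "\<exists>z'. mat_op A (mat_op (QQ 0 (L i)) z) = mat_op (QQ 0 (Suc (L i))) z'"
proof -
  have l: "L i < L s" using i(2) by (rule L_less)
  have av: "poles_avoid_spectrum (take (L i) \<theta>) A"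
    using \<theta>_avoid by (auto simp: poles_avoid_spectrum_def dest: in_set_takeD)
  have take: "take (Suc (L i)) \<theta> = take (L i) \<theta> @ [None]"
    using l len inf[of i] i by (simp add: take_Suc_conv_app_nth)
  have "mat_op (QQ 0 (L i)) z \<in> vec_fun ` rat_krylov A b (take (L i) \<theta>)"
    using is_onb_range[OF onb[of "L i"]] k l by simp
  then have "mat_op A (mat_op (QQ 0 (L i)) z) \<in> vec_fun ` rat_krylov A b (take (Suc (L i)) \<theta>)"
    unfolding take by (rule rat_krylov_extend_infinity[OF A b av])
  then show ?thesis
    using is_onb_range[OF onb[of "Suc (L i)"]] k l by auto
qed

text \<open>By \<open>A_QQ\<close>, \<open>A\<close> maps the first \<open>L i\<close> columns into
  the span of one column more, and self-adjointness transposes the resulting orthogonality. The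
  strict \<open>L i < a\<close> spares column \<open>L i\<close>, the one that may couple.\<close>

lemma QQ_A_zero:
  assumes i: "1 \<le> i" "i < s" and a: "L i < a" and c: "c \<le> L s"
    and X: "dim_row X = n" "\<And>z. \<exists>z'. mat_op X z = mat_op (QQ 0 (L i)) z'"
  shows "mat_op (mat_adjoint X) (mat_op A (mat_op (QQ a c) z)) = 0"
proof (rule adjoint_zero_sym[OF selfadj_mat_op[OF A herm] X(1)])
  show "dim_row (QQ a c) = n" by (simp add: dim_row_Q)
  fix z
  obtain z' where z': "mat_op X z = mat_op (QQ 0 (L i)) z'" using X(2) by blast
  obtain z'' where z'': "mat_op A (mat_op (QQ 0 (L i)) z') = mat_op (QQ 0 (Suc (L i))) z''"
    using A_QQ[OF i] by blast
  show "mat_op (mat_adjoint (QQ a c)) (mat_op A (mat_op X z)) = 0"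
    unfolding z' z'' using a c Suc_leI[OF L_less[OF i(2)]] by (intro QQ_zero) auto
qed

lemma QQ_sub:
  assumes "c \<le> c'" "c' \<le> L s"
  shows "\<exists>z'. mat_op (QQ a c) z = mat_op (QQ 0 c') z'"
proof -
  have "mat_op (QQ a c) z = mat_op (QQ 0 c') (\<lambda>j. if a \<le> j \<and> j < c then z (j - a) else 0)"
    using assms by (auto simp: mat_op_col_range dim_col_Q intro!: mat_op_cong)
  then show ?thesis by blast
qed

lemma QQ_uncons:
  assumes "a < c" "c \<le> L s"
  shows "mat_op (QQ a c) z = scale_fun (z 0) (vec_fun (col Q a)) + mat_op (QQ (Suc a) c) (\<lambda>j. z (Suc j))"
proof
  fix i
  obtain d where d: "c - a = Suc d" "c - Suc a = d" using assms(1) by (metis Suc_diff_Suc)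
  show "mat_op (QQ a c) z i = (scale_fun (z 0) (vec_fun (col Q a)) + mat_op (QQ (Suc a) c) (\<lambda>j. z (Suc j))) i"
    using assms d by (auto simp: mat_op_def scale_fun_def vec_fun_def col_range_index sum.lessThan_Suc_shift
        dim_col_Q simp del: sum.lessThan_Suc)
qed

text \<open>Of all columns from \<open>L i\<close> on, only the first can have a nonzero coupling
  with block \<open>i\<close>; hence the rank is at most one.\<close>

lemma block_coupling_QQ:
  assumes i: "1 \<le> i" "i < s" and c: "L i < c" "c \<le> L s"
  shows "mat_op (mat_adjoint (block k m Q i)) (mat_op A (mat_op (QQ (L i) c) z))
    = scale_fun (z 0) (vec_fun (block_coupling k m A Q i))"
proof -
  let ?B = "block k m Q i"
  have B: "dim_row ?B = n" by (simp add: blocks_def dim_row_Q)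
  have sub: "\<exists>z'. mat_op ?B z = mat_op (QQ 0 (L i)) z'" for z
    unfolding blocks_def by (rule QQ_sub) (use L_le[of i s] i in auto)
  have "col Q (L i) \<in> carrier_vec n" using L_less[OF i(2)] dim_row_Q dim_col_Q by auto
  then have "vec_fun (block_coupling k m A Q i) = mat_op (mat_adjoint ?B) (mat_op A (vec_fun (col Q (L i))))"
    using A B by (simp add: block_coupling_def vec_fun_mult dim_row_Q)
  then show ?thesis
    unfolding QQ_uncons[OF c] op.lin_op_add[OF lin_mat_op] op.lin_op_scale[OF lin_mat_op]
    using QQ_A_zero[OF i _ c(2) B sub, of "Suc (L i)"] by simp
qed

text \<open>The coupling clause covers every range of columns starting at \<open>L i\<close>,
  because each compression is compared with all later blocks still attached and not just with the
  next one.\<close>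

definition cycle_invariant :: "nat \<Rightarrow> bool" where
  "cycle_invariant i \<longleftrightarrow> dim_row (V i) = n \<and> orthonormal_cols (V i) \<and>
    (\<forall>z. \<exists>z'. mat_op (V i) z = mat_op (QQ 0 (L i)) z') \<and>
    S i = compression A (V i) \<and> v i \<in> carrier_vec (dim_col (V i)) \<and>
    (i < s \<longrightarrow> bt i \<in> carrier_vec (dim_col (V i)) \<and>
      (\<forall>c z. L i < c \<longrightarrow> c \<le> L s \<longrightarrow>
        mat_op (mat_adjoint (V i)) (mat_op A (mat_op (QQ (L i) c) z)) = scale_fun (z 0) (vec_fun (bt i))))"

lemma run_first:
  "V 1 = QQ 0 (L 1)" "S 1 = compression A (QQ 0 (L 1))"
  "v 1 = complex_of_real (vec_norm2 b) \<cdot>\<^sub>v unit_vec (k + m) 0"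
  "1 < s \<Longrightarrow> bt 1 = block_coupling k m A Q 1"
  "y 1 = QQ 0 (L 1) *\<^sub>v (mat_fun f (compression A (QQ 0 (L 1))) *\<^sub>v
             (complex_of_real (vec_norm2 b) \<cdot>\<^sub>v unit_vec (k + m) 0))"
proof -
  note first = run[unfolded rk_compressed_lanczos_def blocks_first]
  from first show "V 1 = QQ 0 (L 1)" by (elim conjE)
  from first show "S 1 = compression A (QQ 0 (L 1))" by (elim conjE)
  from first show "v 1 = complex_of_real (vec_norm2 b) \<cdot>\<^sub>v unit_vec (k + m) 0" by (elim conjE)
  from first show "bt 1 = block_coupling k m A Q 1" if "1 < s" using that by (elim conjE) (rule mp)
  from first show "y 1 = QQ 0 (L 1) *\<^sub>v (mat_fun f (compression A (QQ 0 (L 1))) *\<^sub>v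
             (complex_of_real (vec_norm2 b) \<cdot>\<^sub>v unit_vec (k + m) 0))" by (elim conjE)
qed

lemma run_step:
  assumes "1 \<le> i" "i < s"
  shows "is_onb (dim_row (S i)) (U i) (rat_krylov (S i) (bt i) \<xi>)"
    "w i = - ((V i * U i) *\<^sub>v (mat_fun f (compression (S i) (U i)) *\<^sub>v (mat_adjoint (U i) *\<^sub>v v i)))"
    "V (Suc i) = append_cols (V i * U i) (QQ (L i) (L (Suc i)))"
    "v (Suc i) = (mat_adjoint (U i) *\<^sub>v v i) @\<^sub>v 0\<^sub>v m"
    "S (Suc i) = four_block_mat (compression (S i) (U i))
                (mat_adjoint (U i) * outer_prod (bt i) (unit_vec m 0))
                (outer_prod (unit_vec m 0) (bt i) * U i)
                (compression A (QQ (L i) (L (Suc i))))"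
    "Suc i < s \<Longrightarrow> bt (Suc i) = 0\<^sub>v (dim_col (U i)) @\<^sub>v block_coupling k m A Q (Suc i)"
    "y (Suc i) = y i + w i + V (Suc i) *\<^sub>v (mat_fun f (S (Suc i)) *\<^sub>v v (Suc i))"
proof -
  have i': "Suc i \<in> {2..s}" using assms by auto
  have bl: "block k m Q (Suc i) = QQ (L i) (L (Suc i))"
    using blocks_later[of i "Suc i"] assms by simp
  note step = run[unfolded rk_compressed_lanczos_def, THEN conjunct2, THEN conjunct2, THEN conjunct2,
      THEN conjunct2, THEN conjunct2, THEN bspec[OF _ i'], unfolded diff_Suc_1 bl]
  from step show "is_onb (dim_row (S i)) (U i) (rat_krylov (S i) (bt i) \<xi>)" by (elim conjE)
  from step show "w i = - ((V i * U i) *\<^sub>v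
      (mat_fun f (compression (S i) (U i)) *\<^sub>v (mat_adjoint (U i) *\<^sub>v v i)))" by (elim conjE)
  from step show "V (Suc i) = append_cols (V i * U i) (QQ (L i) (L (Suc i)))" by (elim conjE)
  from step show "v (Suc i) = (mat_adjoint (U i) *\<^sub>v v i) @\<^sub>v 0\<^sub>v m" by (elim conjE)
  from step show "S (Suc i) = four_block_mat (compression (S i) (U i))
      (mat_adjoint (U i) * outer_prod (bt i) (unit_vec m 0))
      (outer_prod (unit_vec m 0) (bt i) * U i)
      (compression A (QQ (L i) (L (Suc i))))" by (elim conjE)
  from step show "bt (Suc i) = 0\<^sub>v (dim_col (U i)) @\<^sub>v block_coupling k m A Q (Suc i)" if "Suc i < s"
    using that by (elim conjE) (rule mp)
  from step show "y (Suc i) = y i + w i + V (Suc i) *\<^sub>v (mat_fun f (S (Suc i)) *\<^sub>v v (Suc i))"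
    by (elim conjE)
qed

lemma U_facts:
  assumes "1 \<le> i" "i < s" "cycle_invariant i"
  shows "dim_row (U i) = dim_col (V i)" "orthonormal_cols (U i)"
    "orthonormal_cols (V i * U i)" "dim_row (V i * U i) = n"
    "\<exists>z'. mat_op (V i * U i) z = mat_op (QQ 0 (L i)) z'"
proof -
  show U: "dim_row (U i) = dim_col (V i)" "orthonormal_cols (U i)"
    using run_step(1)[OF assms(1,2)] assms(3) by (simp_all add: is_onb_def cycle_invariant_def orthonormal_cols_def compression_def)
  then show "orthonormal_cols (V i * U i)" "dim_row (V i * U i) = n"
    using assms(3) by (auto simp: cycle_invariant_def intro: orthonormal_mult)
  show "\<exists>z'. mat_op (V i * U i) z = mat_op (QQ 0 (L i)) z'"
    using assms(3) U by (simp add: cycle_invariant_def mat_op_mult)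
qed

lemma V_QQ_zero:
  assumes "\<And>z. \<exists>z'. mat_op X z = mat_op (QQ 0 (L i)) z'" "dim_row X = n" "i \<le> s" "c \<le> L s"
  shows "mat_op (mat_adjoint (QQ (L i) c)) (mat_op X z) = 0"
    "mat_op (mat_adjoint X) (mat_op (QQ (L i) c) z) = 0"
proof -
  show *: "mat_op (mat_adjoint (QQ (L i) c)) (mat_op X z) = 0" for z
  proof -
    obtain z' where "mat_op X z = mat_op (QQ 0 (L i)) z'" using assms(1) by blast
    then show ?thesis using assms L_le[of i s] by (auto intro: QQ_zero)
  qed
  show "mat_op (mat_adjoint X) (mat_op (QQ (L i) c) z) = 0"
    by (rule adjoint_zero_sym[OF selfadj_ident assms(2)]) (simp_all add: dim_row_Q *)
qed

lemma cycle_invariant_first: "cycle_invariant 1"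
proof -
  have l: "L 1 \<le> L s" using s by (intro L_le) simp
  have V1: "V 1 = QQ 0 (L 1)" by (rule run_first)
  have bl: "block k m Q 1 = QQ 0 (L 1)" by (rule blocks_first)
  have "bt 1 \<in> carrier_vec (L 1)" if "1 < s"
    unfolding run_first(4)[OF that] block_coupling_def bl by (rule carrier_vecI) simp
  moreover have "mat_op (mat_adjoint (QQ 0 (L 1))) (mat_op A (mat_op (QQ (L 1) c) z)) = scale_fun (z 0) (vec_fun (bt 1))"
    if "1 < s" "L 1 < c" "c \<le> L s" for c z
    using block_coupling_QQ[of 1, OF _ that] run_first(4)[OF that(1)] unfolding bl by simp
  ultimately show ?thesis
    unfolding cycle_invariant_def V1
    using dim_row_Q orthonormal_col_range[OF Q_on, of "L 1" 0] dim_col_Q l run_first(2,3) by auto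
qed

lemma cycle_invariant_step:
  assumes i: "1 \<le> i" "i < s" and g: "cycle_invariant i"
  shows "cycle_invariant (Suc i)"
proof -
  let ?B = "QQ (L i) (L (Suc i))" and ?K = "V i * U i"
  have V': "V (Suc i) = append_cols ?K ?B" by (rule run_step[OF i])
  have lS: "L (Suc i) \<le> L s" using i by (intro L_le) simp
  have B: "dim_row ?B = n" "orthonormal_cols ?B" "dim_col ?B = m"
    using dim_row_Q dim_col_Q lS by (auto intro: orthonormal_col_range[OF Q_on])
  note K = U_facts[OF i g]
  have Kadj: "mat_op (mat_adjoint ?K) z = mat_op (mat_adjoint (U i)) (mat_op (mat_adjoint (V i)) z)" for z
    using K(1) by (simp add: mat_op_mult mat_adjoint_mult)
  have bt: "bt i \<in> carrier_vec (dim_col (V i))"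
    and coup: "\<And>c z. L i < c \<Longrightarrow> c \<le> L s \<Longrightarrow>
      mat_op (mat_adjoint (V i)) (mat_op A (mat_op (QQ (L i) c) z)) = scale_fun (z 0) (vec_fun (bt i))"
    and Vn: "dim_row (V i) = n" and Si: "S i = compression A (V i)"
    and vi: "v i \<in> carrier_vec (dim_col (V i))"
    using g i(2) by (auto simp: cycle_invariant_def)
  have on: "orthonormal_cols (V (Suc i))"
    unfolding V' using K B i V_QQ_zero[OF K(5) K(4), of "L (Suc i)"] lS
    by (intro orthonormal_append_cols) auto
  have sub: "\<exists>z'. mat_op (V (Suc i)) z = mat_op (QQ 0 (L (Suc i))) z'" for z
  proof -
    obtain z1 where "mat_op ?K z = mat_op (QQ 0 (L i)) z1" using K(5) by blast
    moreover obtain z2 where "mat_op (QQ 0 (L i)) z1 = mat_op (QQ 0 (L (Suc i))) z2"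
      using QQ_sub[OF L_le[OF le_SucI[OF order_refl]] lS] by blast
    moreover obtain z3 where "mat_op ?B (\<lambda>j. z (dim_col ?K + j)) = mat_op (QQ 0 (L (Suc i))) z3"
      using QQ_sub[OF order_refl lS] by blast
    ultimately have "mat_op (V (Suc i)) z = mat_op (QQ 0 (L (Suc i))) (z2 + z3)"
      unfolding V' using K(4) B(1) by (simp only: mat_op_append_cols op.lin_op_add[OF lin_mat_op])
    then show ?thesis by blast
  qed
  \<comment> \<open>The coupling clause for the next block alone; it identifies the off-diagonal
    blocks of \<open>S (Suc i)\<close> with those of an actual compression of
    \<open>A\<close>.\<close>
  have VB: "mat_adjoint (V i) * A * ?B = outer_prod (bt i) (unit_vec m 0)"
  proof (rule mat_op_inj)
    fix z
    show "mat_op (mat_adjoint (V i) * A * ?B) z = mat_op (outer_prod (bt i) (unit_vec m 0)) z"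
      using coup[OF L_less[OF lessI] lS, of z] A B(1) Vn by (simp add: mat_op_mult mat_op_outer_prod_unit[OF m] del: mult_Suc)
  qed (use bt B in simp_all)
  have BV: "mat_adjoint ?B * A * V i = outer_prod (unit_vec m 0) (bt i)"
  proof -
    have "mat_adjoint ?B * A * V i = mat_adjoint (mat_adjoint (V i) * A * ?B)"
      using A B(1) Vn herm
      by (intro mat_op_inj) (simp_all add: mat_adjoint_mult mat_adjoint_adjoint mat_op_mult hermitian_mat_def)
    then show ?thesis unfolding VB mat_adjoint_outer_prod .
  qed
  have "compression A (V (Suc i)) = four_block_mat (compression A ?K) (mat_adjoint ?K * A * ?B)
      (mat_adjoint ?B * A * ?K) (compression A ?B)"
    unfolding V' by (rule four_block_compression[OF A K(4) B(1)])
  also have "compression A ?K = compression (S i) (U i)"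
    unfolding Si by (rule compression_mult[OF A Vn K(1)])
  also have "mat_adjoint ?K * A * ?B = mat_adjoint (U i) * outer_prod (bt i) (unit_vec m 0)"
    unfolding VB[symmetric] using A B(1) Vn K(1)
    by (intro mat_op_inj) (simp_all add: mat_adjoint_mult mat_op_mult)
  also have "mat_adjoint ?B * A * ?K = outer_prod (unit_vec m 0) (bt i) * U i"
    unfolding BV[symmetric] using A B(1) Vn K(1)
    by (intro mat_op_inj) (simp_all add: mat_adjoint_mult mat_op_mult)
  finally have S': "S (Suc i) = compression A (V (Suc i))"
    unfolding run_step(5)[OF i] ..
  have v': "v (Suc i) \<in> carrier_vec (dim_col (V (Suc i)))"
    unfolding run_step(4)[OF i] V' using B(3) K(1) by (intro carrier_vecI) (simp del: mult_Suc)
  have bl: "block k m Q (Suc i) = ?B" using blocks_later[of i "Suc i"] i by simp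
  have bt': "bt (Suc i) \<in> carrier_vec (dim_col (V (Suc i)))" if "Suc i < s"
    unfolding run_step(6)[OF i that] V' using B(3)
    by (intro carrier_vecI) (simp add: block_coupling_def bl del: mult_Suc)
  have coup': "mat_op (mat_adjoint (V (Suc i))) (mat_op A (mat_op (QQ (L (Suc i)) c) z))
      = scale_fun (z 0) (vec_fun (bt (Suc i)))" if "Suc i < s" "L (Suc i) < c" "c \<le> L s" for c z
  proof -
    \<comment> \<open>The old part lies in the span of the first \<open>L i\<close> columns and
      cannot couple past block \<open>Suc i\<close>. This is the zero head of
      \<open>bt (Suc i)\<close>.\<close>
    have 1: "mat_op (mat_adjoint ?K) (mat_op A (mat_op (QQ (L (Suc i)) c) z)) = 0"
      by (rule QQ_A_zero[OF i L_less[of i "Suc i"] that(3) K(4,5)]) simp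
    have 2: "mat_op (mat_adjoint ?B) (mat_op A (mat_op (QQ (L (Suc i)) c) z))
        = scale_fun (z 0) (vec_fun (block_coupling k m A Q (Suc i)))"
      using block_coupling_QQ[of "Suc i", OF _ that] unfolding bl by simp
    have Ksup: "dim_col ?K = dim_col (U i)" by simp
    show ?thesis
      unfolding run_step(6)[OF i that(1)] V' mat_op_adjoint_append_cols[OF B(1)[folded K(4)]] 1 2
        vec_fun_append Ksup
      by (auto simp: fun_eq_iff scale_fun_def vec_fun_def)
  qed
  show ?thesis
    unfolding cycle_invariant_def using on sub S' v' bt' coup' K(4) V' by auto
qed

lemma cycle_invariant: "1 \<le> i \<Longrightarrow> i \<le> s \<Longrightarrow> cycle_invariant i"
proof (induction i)
  case (Suc i)
  then show ?case using cycle_invariant_first cycle_invariant_step[of i] by (cases "i = 0") auto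
qed simp

section \<open>Telescoping over the cycles\<close>

definition cycle_start :: "nat \<Rightarrow> nat \<Rightarrow> complex" where
  "cycle_start i = mat_op (V i) (vec_fun (v i))"

text \<open>The approximation obtained by attaching blocks \<open>i + 1\<close> to \<open>j\<close>
  to \<open>V i\<close> without further compression. For \<open>i = 1\<close> it is the uncompressed
  target, for \<open>i = j\<close> the last summand of \<open>y j\<close>.\<close>

definition cycle_approx :: "nat \<Rightarrow> nat \<Rightarrow> nat \<Rightarrow> complex" where
  "cycle_approx i j = projected_fun f A (append_cols (V i) (QQ (L i) (L j))) (cycle_start i)"

lemma cycle_split:
  assumes i: "1 \<le> i" "i < j" "j \<le> s"
  shows "projected_fun f A (append_cols (V i) (QQ (L i) (L j))) (cycle_start i)
    = projected_fun f A (V i) (cycle_start i) - projected_fun f A (V i * U i) (cycle_start i)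
      + projected_fun f A (append_cols (V i * U i) (QQ (L i) (L j))) (cycle_start i)"
proof -
  let ?Y = "QQ (L i) (L j)"
  have i_s: "i < s" using i by simp
  have g: "cycle_invariant i" using cycle_invariant i by simp
  note K = U_facts[OF i(1) i_s g]
  have Vn: "dim_row (V i) = n" and on: "orthonormal_cols (V i)"
    and sub: "\<And>z. \<exists>z'. mat_op (V i) z = mat_op (QQ 0 (L i)) z'" and Si: "S i = compression A (V i)"
    and bt: "bt i \<in> carrier_vec (dim_col (V i))"
    and coup: "\<And>c z. L i < c \<Longrightarrow> c \<le> L s \<Longrightarrow>
      mat_op (mat_adjoint (V i)) (mat_op A (mat_op (QQ (L i) c) z)) = scale_fun (z 0) (vec_fun (bt i))"
    using g i_s by (auto simp: cycle_invariant_def)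
  have lj: "L j \<le> L s" using i by (intro L_le)
  have lij: "L i < L j" using i by (intro L_less)
  have Y: "dim_row ?Y = n" "orthonormal_cols ?Y"
    using dim_row_Q dim_col_Q lj by (auto intro: orthonormal_col_range[OF Q_on])
  show ?thesis
  proof (cases "p = 0")
    \<comment> \<open>The zero function has no poles, so \<open>cc\<close> does not constrain the
      roots of \<open>q\<close> here; all three terms vanish because \<open>f\<close> does.\<close>
    case True
    then have f0: "f = (\<lambda>_. 0)" using f by simp
    have "projected_fun f A B u = 0" if "dim_row B = n" for B u
    proof -
      let ?N = "compression A B"
      have N: "?N \<in> carrier_mat (dim_col B) (dim_col B)" "hermitian_mat ?N"
        using A herm that by (auto intro: hermitian_compression)
      have "ratio_on_spectrum f 0 1 ?N" by (simp add: ratio_on_spectrum_def f0)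
      from mat_fun_rational_ex[OF N this, of "mat_op (mat_adjoint B) u"]
      have "mat_op (mat_fun f ?N) (mat_op (mat_adjoint B) u) = 0"
        using supported_mat_op[of "mat_adjoint B" u] by (auto simp: zero_fun_def)
      then show ?thesis unfolding projected_fun_def by (simp only: op.lin_op_0[OF lin_mat_op])
    qed
    then show ?thesis using Vn K(4) by simp
  next
    case False
    from real_denominator[OF False q0 cc] obtain p' q' h where
      h: "p = p' * h" "q = q' * h" "map_poly cnj q' = q'" by blast
    have nz: "p' \<noteq> 0" "q' \<noteq> 0" "h \<noteq> 0" using h False q0 by auto
    have degp: "degree p' + degree h < k"
      using dp k h(1) nz by (simp add: degree_mult_eq)
    have degq: "degree q' + degree h \<le> k"
      using dq h(2) nz by (simp add: degree_mult_eq)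
    \<comment> \<open>Cancelling \<open>h\<close> turns the type \<open>(k - 1, k)\<close> into
      \<open>(?k - 1, ?k)\<close>, and this is also the degree range that
      \<open>krylov_reduced_generator\<close> provides inside \<open>U i\<close>.\<close>
    let ?k = "k - degree h"
    have k': "0 < ?k" using degp by simp
    have S: "S i \<in> carrier_mat (dim_col (V i)) (dim_col (V i))" unfolding Si using A Vn by simp
    have "is_onb (dim_col (V i)) (U i) (rat_krylov (S i) (bt i) \<xi>)"
      using run_step(1)[OF i(1) i_s] S by simp
    then obtain \<kappa> where \<kappa>: "op.papp (mat_op (S i)) q' \<kappa> = vec_fun (bt i)"
        "\<And>r. deg_less r ?k \<Longrightarrow> \<exists>z. op.papp (mat_op (S i)) r \<kappa> = mat_op (U i) z"
      using krylov_reduced_generator[OF S bt \<xi>_avoid q0 dq h(2) \<xi>] degp i i_s by fastforce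
    have ratio: "ratio_on_spectrum f p' q' N" if "denom_nonzero_on_spectrum q N" for N
      using that by (auto simp: denom_nonzero_on_spectrum_def ratio_on_spectrum_def f h(1,2))
    have e: "append_cols B (blocks k m Q (i + 1) i) = B" if "dim_row B = n" for B
      using that dim_row_Q i(1) by (intro append_cols_empty) (simp_all add: blocks_def)
    have bl: "blocks k m Q (i + 1) j = ?Y" using blocks_later i(1) by simp
    have dn: "denom_nonzero_on_spectrum q (compression A (V i))"
      "denom_nonzero_on_spectrum q (compression A (V i * U i))"
      "denom_nonzero_on_spectrum q (compression A (append_cols (V i) ?Y))"
      "denom_nonzero_on_spectrum q (compression A (append_cols (V i * U i) ?Y))"
    proof -
      have d1: "denom_nonzero_on_spectrum q (compression A (append_cols (V i) (blocks k m Q (i + 1) j')))"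
        and d2: "denom_nonzero_on_spectrum q (compression A (append_cols (V i * U i) (blocks k m Q (i + 1) j')))"
        if "i \<le> j'" "j' \<le> s" for j'
        using denom i i_s that unfolding denom_nonzero_on_projections_def by auto
      show "denom_nonzero_on_spectrum q (compression A (V i))"
        "denom_nonzero_on_spectrum q (compression A (V i * U i))"
        using d1[of i] d2[of i] i_s e[OF Vn] e[OF K(4)] by simp_all
      show "denom_nonzero_on_spectrum q (compression A (append_cols (V i) ?Y))"
        "denom_nonzero_on_spectrum q (compression A (append_cols (V i * U i) ?Y))"
        using d1[of j] d2[of j] i bl by simp_all
    qed
    show ?thesis
    proof (rule projected_fun_split[OF A herm Vn on Y K(1,2) _ _ _ _ k' _ _ h(3) \<kappa>(1)[unfolded Si] \<kappa>(2)[unfolded Si]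
          ratio[OF dn(1)] ratio[OF dn(2)] ratio[OF dn(3)] ratio[OF dn(4)]])
      show "mat_op (mat_adjoint (V i)) (mat_op ?Y z) = 0" "mat_op (mat_adjoint ?Y) (mat_op (V i) z) = 0" for z
        using V_QQ_zero[OF sub Vn _ lj] i_s by simp_all
      show "mat_op (mat_adjoint (V i)) (mat_op A (mat_op ?Y z)) = scale_fun (z 0) (vec_fun (bt i))" for z
        by (rule coup[OF lij lj])
      show "0 < dim_col ?Y" using lij by simp
      show "deg_less q' (Suc ?k)" "deg_less p' ?k" using degp degq k' by (auto simp: deg_less_iff)
      show "proj (V i) (cycle_start i) = cycle_start i" unfolding cycle_start_def by (rule proj_mat_op[OF on])
    qed
  qed
qed

text \<open>\<open>cycle_split\<close> read in terms of the run: its subtracted term is the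
  correction \<open>w i\<close>, and its last term is the approximation with which the next cycle
  starts.\<close>

lemma cycle_approx_step:
  assumes i: "1 \<le> i" "i < j" "j \<le> s"
  shows "cycle_approx i j = cycle_approx i i + vec_fun (w i) + cycle_approx (Suc i) j"
proof -
  let ?K = "V i * U i" and ?Y = "QQ (L i) (L j)"
  have i_s: "i < s" using i by simp
  have g: "cycle_invariant i" using cycle_invariant i by simp
  note K = U_facts[OF i(1) i_s g]
  have Vn: "dim_row (V i) = n" and on: "orthonormal_cols (V i)"
    and sub: "\<And>z. \<exists>z'. mat_op (V i) z = mat_op (QQ 0 (L i)) z'" and Si: "S i = compression A (V i)"
    and vi: "v i \<in> carrier_vec (dim_col (V i))"
    using g i_s by (auto simp: cycle_invariant_def)
  have Y: "dim_row ?Y = dim_row ?K" using dim_row_Q K(4) by simp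
  have Kx: "mat_op (mat_adjoint ?K) (cycle_start i) = vec_fun (mat_adjoint (U i) *\<^sub>v v i)"
    unfolding cycle_start_def using K(1) vi mat_op_adjoint_range[OF on vi]
    by (simp add: mat_op_mult mat_adjoint_mult vec_fun_mult)
  have w: "vec_fun (w i) = - projected_fun f A ?K (cycle_start i)"
    unfolding run_step(2)[OF i(1) i_s] Si vec_fun_uminus compression_mult[OF A Vn K(1), symmetric]
    by (rule arg_cong[where f = uminus], rule projected_fun_vec[OF A herm K(4) _ Kx])
      (use K(1) vi in \<open>auto intro!: carrier_vecI\<close>)
  have x': "cycle_start (Suc i) = mat_op ?K (vec_fun (mat_adjoint (U i) *\<^sub>v v i))"
  proof -
    let ?u = "mat_adjoint (U i) *\<^sub>v v i"
    have u: "dim_vec ?u = dim_col ?K" by simp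
    have "mat_op ?K (vec_fun (?u @\<^sub>v 0\<^sub>v m)) = mat_op ?K (vec_fun ?u)"
      by (rule mat_op_cong) (simp add: vec_fun_append)
    moreover have "mat_op (QQ (L i) (L (Suc i))) (\<lambda>j. vec_fun (?u @\<^sub>v 0\<^sub>v m) (dim_col ?K + j)) = 0"
    proof -
      have "(\<lambda>j. vec_fun (?u @\<^sub>v 0\<^sub>v m) (dim_col ?K + j)) = 0"
        by (auto simp: vec_fun_append fun_eq_iff) (simp add: vec_fun_def)
      then show ?thesis by (simp only: op.lin_op_0[OF lin_mat_op])
    qed
    ultimately show ?thesis
      unfolding cycle_start_def run_step(3,4)[OF i(1) i_s] using K(4) dim_row_Q by (simp add: mat_op_append_cols)
  qed
  have Yx: "mat_op (mat_adjoint ?Y) (cycle_start i) = 0"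
    unfolding cycle_start_def by (rule V_QQ_zero[OF sub Vn]) (use i in auto)
  have Yx': "mat_op (mat_adjoint ?Y) (cycle_start (Suc i)) = 0"
    unfolding x' by (rule V_QQ_zero[OF K(5,4)]) (use i in auto)
  have Kx': "mat_op (mat_adjoint ?K) (cycle_start (Suc i)) = vec_fun (mat_adjoint (U i) *\<^sub>v v i)"
    unfolding x' by (rule mat_op_adjoint_range[OF K(3)]) (auto intro!: carrier_vecI)
  have "append_cols (V (Suc i)) (QQ (L (Suc i)) (L j)) = append_cols ?K ?Y"
    unfolding run_step(3)[OF i(1) i_s]
    by (rule append_cols_col_range) (use K(4) dim_row_Q i L_le[of "Suc i" j] in auto)
  \<comment> \<open>\<open>cycle_start (Suc i)\<close> is the projection of
    \<open>cycle_start i\<close> onto the columns of \<open>?K\<close>. Both have the same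
    coordinates in \<open>?K\<close> and none in \<open>?Y\<close>, so the projected function cannot
    distinguish them.\<close>
  then have G': "cycle_approx (Suc i) j = projected_fun f A (append_cols ?K ?Y) (cycle_start i)"
    unfolding cycle_approx_def projected_fun_def mat_op_adjoint_append_cols[OF Y] Yx Yx' Kx Kx'
    by (simp only: mat_op_adjoint_append_cols[OF Y] Yx Yx' Kx Kx')
  have "append_cols (V i) (QQ (L i) (L i)) = V i"
    by (rule append_cols_empty) (use Vn dim_row_Q in simp_all)
  then show ?thesis
    unfolding G' w using cycle_split[OF i] by (simp add: cycle_approx_def)
qed

text \<open>In \<open>y i\<close> the last summand is replaced by its continuation up to block
  \<open>j\<close>. All later \<open>j\<close> are carried along because the induction raises
  \<open>i\<close> with \<open>j\<close> fixed; the case \<open>j = i\<close> gives the equality of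
  \<open>y i\<close> with the target.\<close>

lemma y_eq_cycle_approx:
  assumes "1 \<le> i" "i \<le> s"
  shows "dim_vec (y i) = n \<and> (\<forall>j\<in>{i..s}. cycle_approx 1 j = vec_fun (y i) - cycle_approx i i + cycle_approx i j)"
  using assms
proof (induction i)
  case (Suc i)
  have Gii: "cycle_approx i' i' = vec_fun (V i' *\<^sub>v (mat_fun f (S i') *\<^sub>v v i'))" if "1 \<le> i'" "i' \<le> s" for i'
  proof -
    have g: "dim_row (V i') = n" "orthonormal_cols (V i')" "S i' = compression A (V i')"
      "v i' \<in> carrier_vec (dim_col (V i'))" using cycle_invariant[OF that] by (auto simp: cycle_invariant_def)
    have e: "append_cols (V i') (QQ (L i') (L i')) = V i'"
      by (rule append_cols_empty) (use g dim_row_Q in simp_all)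
    show ?thesis
      unfolding cycle_approx_def e g(3) by (rule projected_fun_vec[OF A herm g(1,4), symmetric])
        (simp add: cycle_start_def mat_op_adjoint_range[OF g(2,4)])
  qed
  show ?case
  proof (cases "i = 0")
    case True
    have "y 1 = V 1 *\<^sub>v (mat_fun f (S 1) *\<^sub>v v 1)" by (simp only: run_first)
    moreover have "dim_row (V 1) = n" using cycle_invariant[of 1] s by (simp add: cycle_invariant_def)
    ultimately show ?thesis using Gii[of 1] s True by simp
  next
    case False
    then have i: "1 \<le> i" "i < s" using Suc.prems by auto
    then have IH: "dim_vec (y i) = n" "\<And>j. j \<in> {i..s} \<Longrightarrow> cycle_approx 1 j = vec_fun (y i) - cycle_approx i i + cycle_approx i j"
      using Suc.IH by auto
    have dw: "dim_vec (w i) = n" using run_step(2)[OF i] U_facts(4)[OF i cycle_invariant] i by simp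
    have dV: "dim_row (V (Suc i)) = n" using cycle_invariant[OF Suc.prems] by (simp add: cycle_invariant_def)
    have y: "vec_fun (y (Suc i)) = vec_fun (y i) + vec_fun (w i) + cycle_approx (Suc i) (Suc i)"
      unfolding run_step(7)[OF i] Gii[OF Suc.prems] using IH(1) dw dV
      by (simp add: vec_fun_add)
    have "cycle_approx 1 j = vec_fun (y (Suc i)) - cycle_approx (Suc i) (Suc i) + cycle_approx (Suc i) j" if "j \<in> {Suc i..s}" for j
      using IH(2)[of j] cycle_approx_step[of i j] i that unfolding y by (simp add: algebra_simps)
    then show ?thesis using run_step(7)[OF i] dV by simp
  qed
qed simp

theorem y_eq:
  assumes i: "1 \<le> i" "i \<le> s"
  shows "y i = QQ 0 (L i) *\<^sub>v (mat_fun f (compression A (QQ 0 (L i))) *\<^sub>v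
      (complex_of_real (vec_norm2 b) \<cdot>\<^sub>v unit_vec (L i) 0))"
proof (rule vec_fun_inj)
  let ?c = "complex_of_real (vec_norm2 b)"
  have li: "L i \<le> L s" "L 1 \<le> L i" "L 1 \<le> L s" using i by (auto intro: L_le)
  show "dim_vec (y i) = dim_vec (QQ 0 (L i) *\<^sub>v (mat_fun f (compression A (QQ 0 (L i))) *\<^sub>v (?c \<cdot>\<^sub>v unit_vec (L i) 0)))"
    using y_eq_cycle_approx[OF i] by (simp add: dim_row_Q)
  \<comment> \<open>Before any compression \<open>V 1\<close> is the first block itself, so
    attaching the following blocks restores the full basis.\<close>
  have "append_cols (QQ 0 (L 1)) (QQ (L 1) (L i)) = QQ 0 (L i)"
  proof (rule eq_matI)
    fix r j assume "r < dim_row (QQ 0 (L i))" "j < dim_col (QQ 0 (L i))"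
    then show "append_cols (QQ 0 (L 1)) (QQ (L 1) (L i)) $$ (r, j) = QQ 0 (L i) $$ (r, j)"
      using li by (simp add: append_cols_index col_range_index)
  qed (use li in simp_all)
  then have G1: "cycle_approx 1 i = projected_fun f A (QQ 0 (L i)) (cycle_start 1)" by (simp only: cycle_approx_def run_first(1))
  have "mat_op (mat_adjoint (QQ 0 (L i))) (cycle_start 1) = vec_fun (?c \<cdot>\<^sub>v unit_vec (L i) 0)"
    unfolding cycle_start_def run_first(1,3) using li k
    by (auto simp: mat_op_adjoint_col_range_col_range[OF Q_on] dim_col_Q vec_fun_unit fun_eq_iff)
  then have "projected_fun f A (QQ 0 (L i)) (cycle_start 1)
      = vec_fun (QQ 0 (L i) *\<^sub>v (mat_fun f (compression A (QQ 0 (L i))) *\<^sub>v (?c \<cdot>\<^sub>v unit_vec (L i) 0)))"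
    by (intro projected_fun_vec[symmetric, OF A herm]) (simp_all add: dim_row_Q)
  then show "vec_fun (y i) = vec_fun (QQ 0 (L i) *\<^sub>v (mat_fun f (compression A (QQ 0 (L i))) *\<^sub>v
      (?c \<cdot>\<^sub>v unit_vec (L i) 0)))"
    using y_eq_cycle_approx[OF i] i G1 by simp
qed

end

theorem proposition4p1:
  fixes A Q :: "complex mat" and b :: "complex vec" and n k m s M :: nat
    and \<theta> \<xi> :: "pole list" and p q :: "complex poly" and f :: "complex \<Rightarrow> complex"
    and U V S :: "nat \<Rightarrow> complex mat" and v bt w y :: "nat \<Rightarrow> complex vec"
  assumes "A \<in> carrier_mat n n" and "hermitian_mat A"
    and "b \<in> carrier_vec n" and "b \<noteq> 0\<^sub>v n"
    and "k > 0" and "m > 0" and "s > 0" and "M = k + s * m"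
    and "length \<theta> = M" and "conj_closed_poles \<theta>"
    and "\<theta> ! 0 = None" and "\<forall>i\<in>{1..s - 1}. \<theta> ! (k + i * m) = None"
    and "degree p \<le> k - 1" and "degree q \<le> k" and "q \<noteq> 0"
    and "conj_closed (rat_roots p q)" and "conj_closed (rat_poles p q)"
    and "f = (\<lambda>x. poly p x / poly q x)"
    and "mset \<xi> = image_mset Some (proots q) + replicate_mset (k - degree q) None"
    and "rat_lanczos_basis A b \<theta> Q"
    and "rk_compressed_lanczos f A b k m s \<xi> Q U V S v bt w y"
    and "poles_avoid_spectrum \<theta> A"
    and "\<forall>i\<in>{1..s}. poles_avoid_spectrum \<xi> (S i)"
    and "denom_nonzero_on_projections q A k m s Q U V"
  shows "\<forall>i\<in>{1..s}.
    y i = col_range Q 0 (k + i * m) *\<^sub>v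
      (mat_fun f (compression A (col_range Q 0 (k + i * m))) *\<^sub>v
        (complex_of_real (vec_norm2 b) \<cdot>\<^sub>v unit_vec (k + i * m) 0))"
proof -
  interpret rk_run A Q b n k m s \<theta> \<xi> p q f U V S v bt w y
    by unfold_locales (use assms in blast)+
  show ?thesis using y_eq by simp
qed

end
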